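(* Let $a>0$, $\sigma>1$, $\nu>0$, and let $u^0\in Z^{-1}_{a,\sigma}(\mathbb R^3)$ be divergence free. Then there exist a time $T>0$ and a unique solution $u\in\mathcal C([0,T],Z^{-1}_{a,\sigma}(\mathbb R^3))\cap L^1([0,T],Z^{1}_{a,\sigma}(\mathbb R^3))$ of (NSE) on $[0,T]$ with initial data $u^0$.
   Context: (NSE) denotes the 3D incompressible Navier–Stokes system $\partial_t u-\nu\Delta u+u\cdot\nabla u=-\nabla p$, $\operatorname{div}u=0$ on $\mathbb R^3$, $u(0,x)=u^0(x)$, with viscosity $\nu>0$; solutions are understood in the integral (mild) form $u(t)=e^{\nu t\Delta}u^0-\int_0^te^{\nu(t-\tau)\Delta}(u\cdot\nabla u)(\tau)\,d\tau$ (pressure eliminated). The Fourier transform is $\hat f(\xi)=\int_{\mathbb R^3}e^{-ix\cdot\xi}f(x)\,dx$. For $a>0$, $\sigma>1$, $\rho\in\mathbb R$, $Z^{\rho}_{a,\sigma}(\mathbb R^3)$ is the set of $f\in\mathcal S'(\mathbb R^3)$ with $\|f\|_{Z^{\rho}_{a,\sigma}}=\int_{\mathbb R^3}|\xi|^{\rho}e^{a|\xi|^{1/\sigma}}|\hat f(\xi)|\,d\xi<\infty$.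
   Formalization: The integral form of (NSE) is taken with the Leray projector applied to u·∇u, which eliminating the pressure requires; without it the formula is incompatible with div u = 0. *)

theory Defs
  imports "HOL-Analysis.Analysis"
begin

text \<open>Everything is formulated on the Fourier side: a (vector) distribution u in
  Z^rho_{a,sigma}(R^3)^3 is identified with its Fourier transform, a measurable function
  R^3 -> C^3 (determined up to a.e. equality).  Convention: hat f(xi) = int e^{-i x.xi} f(x) dx.\<close>

definition zweight :: "real \<Rightarrow> real \<Rightarrow> real \<Rightarrow> real^3 \<Rightarrow> real" where
  "zweight \<rho> a \<sigma> \<xi> = norm \<xi> powr \<rho> * exp (a * norm \<xi> powr (1 / \<sigma>))"

definition Znorm :: "real \<Rightarrow> real \<Rightarrow> real \<Rightarrow> (real^3 \<Rightarrow> complex^3) \<Rightarrow> ennreal" where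
  "Znorm \<rho> a \<sigma> f = (\<integral>\<^sup>+ \<xi>. ennreal (zweight \<rho> a \<sigma> \<xi> * norm (f \<xi>)) \<partial>lborel)"

definition Zspace :: "real \<Rightarrow> real \<Rightarrow> real \<Rightarrow> (real^3 \<Rightarrow> complex^3) set" where
  "Zspace \<rho> a \<sigma> = {f. f \<in> borel_measurable lborel \<and> Znorm \<rho> a \<sigma> f < \<infinity>}"

definition leray :: "real^3 \<Rightarrow> complex^3 \<Rightarrow> complex^3" where
  "leray \<xi> w = (\<chi> k. w $ k - ((\<Sum>j\<in>UNIV. complex_of_real (\<xi> $ j) * w $ j)
                  / complex_of_real ((norm \<xi>)\<^sup>2)) * complex_of_real (\<xi> $ k))"

text \<open>Integrand of the Fourier transform of u.grad u (before division by (2 pi)^3):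
  (u_j d_j u_k)^(xi) = (2 pi)^(-3) sum_j int hat u_j(xi - eta) (i eta_j) hat u_k(eta) d eta.\<close>
definition nonlin_integrand :: "(real^3 \<Rightarrow> complex^3) \<Rightarrow> real^3 \<Rightarrow> real^3 \<Rightarrow> complex^3" where
  "nonlin_integrand w \<xi> \<eta> =
     (\<chi> k. (\<Sum>j\<in>UNIV. w (\<xi> - \<eta>) $ j * (\<i> * complex_of_real (\<eta> $ j)) * w \<eta> $ k))"

definition duhamel_integrand ::
  "real \<Rightarrow> (real \<Rightarrow> real^3 \<Rightarrow> complex^3) \<Rightarrow> real \<Rightarrow> real^3 \<Rightarrow> real \<times> (real^3) \<Rightarrow> complex^3" where
  "duhamel_integrand \<nu> v t \<xi> p =
     (exp (- \<nu> * (t - fst p) * (norm \<xi>)\<^sup>2) / (2 * pi) ^ 3)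
       *\<^sub>R leray \<xi> (nonlin_integrand (v (fst p)) \<xi> (snd p))"

definition NS_mild_solution ::
  "real \<Rightarrow> real \<Rightarrow> real \<Rightarrow> real \<Rightarrow> (real^3 \<Rightarrow> complex^3) \<Rightarrow> (real \<Rightarrow> real^3 \<Rightarrow> complex^3) \<Rightarrow> bool" where
  "NS_mild_solution \<nu> a \<sigma> T u0 v \<longleftrightarrow>
     (\<forall>t\<in>{0..T}. v t \<in> Zspace (-1) a \<sigma>) \<and>
     (\<forall>t\<in>{0..T}. ((\<lambda>s. Znorm (-1) a \<sigma> (\<lambda>\<xi>. v s \<xi> - v t \<xi>)) \<longlongrightarrow> 0) (at t within {0..T})) \<and>
     (\<integral>\<^sup>+ t\<in>{0..T}. Znorm 1 a \<sigma> (v t) \<partial>lborel) < \<infinity> \<and>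
     (\<forall>t\<in>{0..T}. AE \<xi> in lborel.
        set_integrable lborel ({0..t} \<times> UNIV) (duhamel_integrand \<nu> v t \<xi>) \<and>
        v t \<xi> = exp (- \<nu> * t * (norm \<xi>)\<^sup>2) *\<^sub>R u0 \<xi>
                 - (LINT p : {0..t} \<times> UNIV | lborel. duhamel_integrand \<nu> v t \<xi> p))"

end

theory Submission
  imports Defs
begin

text \<open>The Leray projection makes every solution of the Duhamel equation divergence free, so the factor
  \<open>\<eta>\<close> in the nonlinearity may be traded for \<open>\<xi>\<close>; the weight \<open>e\<^bsup>a|\<xi>|^(1/\<sigma>)\<^esup>\<close> is submultiplicative.
  Hence the \<open>Z\<^sup>-\<^sup>1\<close> norm of the nonlinearity is at most \<open>\<parallel>u\<parallel>\<^sup>2\<close> in \<open>Z\<^sup>0\<close>, heat smoothing controls the Duhamel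
  term in \<open>L\<^sup>\<infinity>Z\<^sup>-\<^sup>1 \<inter> L\<^sup>1Z\<^sup>1\<close>, and interpolation (Cauchy--Schwarz) brings this back to \<open>L\<^sup>2Z\<^sup>0\<close>, where the heat
  flow of the data is small for short time.
  Existence: the scalar Picard iteration for the norms is monotone and bounded in \<open>L\<^sup>2Z\<^sup>0\<close>; its limit
  is finite almost everywhere and majorises, increment by increment, the vector-valued Picard iteration,
  which therefore converges pointwise and dominatedly. Uniqueness: the \<open>L\<^sup>2Z\<^sup>0\<close> estimate for the
  difference of two solutions closes on time intervals where their \<open>L\<^sup>2Z\<^sup>0\<close> norms are small, and
  finitely many such intervals cover \<open>[0,T]\<close>.\<close>

subsection \<open>Extended nonnegative reals\<close>

lemma ennreal_norm_triangle_ineq4: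
  fixes x y :: "'a::real_normed_vector"
  shows "ennreal (norm (x - y)) \<le> ennreal (norm x) + ennreal (norm y)"
  using ennreal_leI[OF norm_triangle_ineq4[of x y]] by simp

lemma ennreal_norm_triangle_sub:
  fixes x y :: "'a::real_normed_vector"
  shows "ennreal (norm x) \<le> ennreal (norm (x - y)) + ennreal (norm y)"
  using ennreal_leI[OF norm_triangle_sub[of x y]] by (simp add: add.commute)

lemma power2_add_le_ennreal: "(x + y)\<^sup>2 \<le> 2 * x\<^sup>2 + 2 * y\<^sup>2" for x y :: ennreal
proof -
  have "(x + y)\<^sup>2 = x\<^sup>2 + y\<^sup>2 + 2 * x * y"
    by (simp add: power2_sum)
  also have "\<dots> \<le> x\<^sup>2 + y\<^sup>2 + (x\<^sup>2 + y\<^sup>2)"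
    by (intro add_left_mono sum_of_squares_ge_ennreal)
  also have "\<dots> = 2 * x\<^sup>2 + 2 * y\<^sup>2"
    unfolding mult_2 by (simp add: ac_simps)
  finally show ?thesis .
qed

lemma power2_SUP_ennreal:
  fixes f :: "nat \<Rightarrow> ennreal"
  assumes "incseq f"
  shows "(SUP n. f n)\<^sup>2 = (SUP n. (f n)\<^sup>2)"
proof (rule LIMSEQ_unique)
  have "(\<lambda>n. (f n)\<^sup>2) \<longlonglongrightarrow> S\<^sup>2" if "f \<longlonglongrightarrow> S" for S
    unfolding power2_eq_square using that by (intro tendsto_mult_ennreal) auto
  then show "(\<lambda>n. (f n)\<^sup>2) \<longlonglongrightarrow> (SUP n. f n)\<^sup>2"
    using LIMSEQ_SUP[OF assms] .
  show "(\<lambda>n. (f n)\<^sup>2) \<longlonglongrightarrow> (SUP n. (f n)\<^sup>2)"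
    using assms by (intro LIMSEQ_SUP) (auto simp: incseq_def intro: power_mono)
qed

lemma ennreal_eq_0_if_le_mult_self:
  fixes x c :: ennreal
  assumes "x \<le> c * x" "c < 1" "x < \<infinity>"
  shows "x = 0"
proof (rule ccontr)
  assume "x \<noteq> 0"
  then have "c * x < 1 * x"
    using assms by (intro ennreal_mult_strict_right_mono) (auto simp: zero_less_iff_neq_zero)
  with assms(1) show False by simp
qed

lemma convergent_if_dominated_increments:
  fixes v :: "nat \<Rightarrow> 'a::banach" and m :: "nat \<Rightarrow> ennreal"
  assumes step: "\<And>n. ennreal (norm (v (Suc n) - v n)) + m n \<le> m (Suc n)"
    and finite: "(SUP n. m n) < \<infinity>"
  shows "convergent v"
proof -
  have m_le: "m n \<le> (SUP n. m n)" for n by (rule SUP_upper) simp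
  have m_less: "m n < top" for n
    using m_le[of n] finite by (auto simp: order.strict_trans1)
  have step': "norm (v (Suc n) - v n) \<le> enn2real (m (Suc n)) - enn2real (m n)" for n
  proof -
    have "enn2real (ennreal (norm (v (Suc n) - v n)) + m n) \<le> enn2real (m (Suc n))"
      by (rule enn2real_mono[OF step m_less])
    then show ?thesis using m_less by (simp add: enn2real_plus)
  qed
  have "summable (\<lambda>n. norm (v (Suc n) - v n))"
  proof (rule bounded_imp_summable)
    fix n
    have "(\<Sum>k\<le>n. norm (v (Suc k) - v k)) \<le> (\<Sum>k\<le>n. enn2real (m (Suc k)) - enn2real (m k))"
      by (intro sum_mono step')
    also have "\<dots> = enn2real (m (Suc n)) - enn2real (m 0)"
      by (induction n) auto
    also have "\<dots> \<le> enn2real (m (Suc n))" by simp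
    also have "\<dots> \<le> enn2real (SUP n. m n)"
      using finite by (intro enn2real_mono m_le) simp
    finally show "(\<Sum>k\<le>n. norm (v (Suc k) - v k)) \<le> enn2real (SUP n. m n)" .
  qed simp
  then have "convergent (\<lambda>n. \<Sum>k<n. v (Suc k) - v k)"
    unfolding summable_iff_convergent[symmetric] by (rule summable_norm_cancel)
  then have "convergent (\<lambda>n. (v n - v 0) + v 0)"
    by (intro convergent_add) (simp_all add: sum_lessThan_telescope convergent_const)
  then show ?thesis by simp
qed

subsection \<open>Lebesgue measure and measurability\<close>

abbreviation jointly_measurable ::
  "('a::topological_space \<Rightarrow> 'b::topological_space \<Rightarrow> 'c::topological_space) \<Rightarrow> bool" where
  "jointly_measurable f \<equiv> case_prod f \<in> borel_measurable (borel \<Otimes>\<^sub>M borel)"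

lemma borel_measurable_lborel_prodI:
  fixes f :: "'a::euclidean_space \<times> 'b::euclidean_space \<Rightarrow> 'c::topological_space"
  shows "f \<in> borel_measurable (borel \<Otimes>\<^sub>M borel) \<Longrightarrow> f \<in> borel_measurable lborel"
  by (simp add: borel_prod)

lemma measurable_indicator_atLeastAtMost [measurable (raw)]:
  fixes l u x :: "'a \<Rightarrow> real"
  assumes [measurable]: "l \<in> borel_measurable M" "u \<in> borel_measurable M" "x \<in> borel_measurable M"
  shows "(\<lambda>z. indicator {l z..u z} (x z) :: 'b::{zero_neq_one, topological_space}) \<in> borel_measurable M"
proof -
  have "(\<lambda>z. indicator {l z..u z} (x z) :: 'b) = (\<lambda>z. if l z \<le> x z \<and> x z \<le> u z then 1 else 0)"
    by (auto simp: fun_eq_iff)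
  then show ?thesis by simp
qed

lemma measurable_vec_nth_compose [measurable (raw)]:
  fixes f :: "'a \<Rightarrow> 'b::{real_normed_vector, second_countable_topology} ^ 'n"
  assumes "f \<in> borel_measurable M"
  shows "(\<lambda>x. f x $ i) \<in> borel_measurable M"
proof (rule measurable_compose[OF assms])
  show "(\<lambda>x::'b^'n. x $ i) \<in> borel_measurable borel"
    by (intro borel_measurable_continuous_onI continuous_intros)
qed

lemma borel_measurable_vecI:
  fixes f :: "'a \<Rightarrow> 'b::euclidean_space ^ 'n"
  assumes "\<And>i. (\<lambda>x. f x $ i) \<in> borel_measurable M"
  shows "f \<in> borel_measurable M"
proof (subst borel_measurable_euclidean_space, safe)
  fix b :: "'b^'n" assume "b \<in> Basis"
  then obtain i u where "b = axis i u" by (auto simp: Basis_vec_def)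
  then show "(\<lambda>x. f x \<bullet> b) \<in> borel_measurable M"
    using assms[of i] by (simp add: inner_axis borel_measurable_inner)
qed

lemma nn_integral_lborel_minus_const:
  fixes f :: "'a::euclidean_space \<Rightarrow> ennreal"
  assumes [measurable]: "f \<in> borel_measurable borel"
  shows "(\<integral>\<^sup>+x. f (x - c) \<partial>lborel) = (\<integral>\<^sup>+x. f x \<partial>lborel)"
  by (subst (2) lborel_distr_plus[of "-c", symmetric]) (simp add: nn_integral_distr)

lemma AE_lborel_diff:
  fixes c :: "'a::euclidean_space"
  assumes "AE x in lborel. P x"
  shows "AE x in lborel. P (c - x)"
proof (rule AE_distrD[where M' = borel and f = "\<lambda>x. c - x"])
  have "distr lborel borel (\<lambda>x. c - x) = lborel"
    using lborel_affine[of "-1" c] by (simp add: density_1)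
  with assms show "AE x in distr lborel borel (\<lambda>x. c - x). P x" by (simp only:)
qed simp

lemma nn_integral_lborel_commute:
  fixes f :: "'a::euclidean_space \<Rightarrow> 'b::euclidean_space \<Rightarrow> ennreal"
  assumes "jointly_measurable f"
  shows "(\<integral>\<^sup>+x. \<integral>\<^sup>+y. f x y \<partial>lborel \<partial>lborel) = (\<integral>\<^sup>+y. \<integral>\<^sup>+x. f x y \<partial>lborel \<partial>lborel)"
proof (rule lborel_pair.Fubini'[symmetric])
  show "case_prod f \<in> borel_measurable (lborel \<Otimes>\<^sub>M lborel)"
    using assms by (simp add: lborel_prod borel_prod)
qed

lemma nn_integral_lborel_prod_eq_iterated:
  fixes f :: "'a::euclidean_space \<Rightarrow> 'b::euclidean_space \<Rightarrow> ennreal"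
  assumes "jointly_measurable f"
  shows "(\<integral>\<^sup>+p. f (fst p) (snd p) \<partial>lborel) = (\<integral>\<^sup>+x. \<integral>\<^sup>+y. f x y \<partial>lborel \<partial>lborel)"
proof -
  have "case_prod f \<in> borel_measurable (lborel \<Otimes>\<^sub>M lborel)"
    using assms by (simp add: lborel_prod borel_prod)
  from lborel.nn_integral_fst[OF this] show ?thesis
    by (simp add: lborel_prod case_prod_beta')
qed

lemma AE_lborel_pairI:
  fixes P :: "'a::euclidean_space \<times> 'b::euclidean_space \<Rightarrow> bool"
  assumes "Measurable.pred (borel \<Otimes>\<^sub>M borel) P"
    and "AE x in lborel. AE y in lborel. P (x, y)"
  shows "AE p in lborel. P p"
proof -
  have "AE p in lborel \<Otimes>\<^sub>M lborel. P p"
    using assms sets_pair_measure_cong[OF sets_lborel sets_lborel]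
    by (intro lborel_pair.AE_pair_measure) (auto simp: pred_def space_pair_measure)
  then show ?thesis unfolding lborel_prod .
qed

lemma AE_lborel_snd:
  fixes P :: "'b::euclidean_space \<Rightarrow> bool"
  assumes "AE y in lborel. P y"
  shows "AE p in (lborel :: ('a::euclidean_space \<times> 'b) measure). P (snd p)"
proof -
  from assms obtain N where N: "{y. \<not> P y} \<subseteq> N" "emeasure lborel N = 0" "N \<in> sets borel"
    by (auto elim!: AE_E)
  have "AE p in (lborel :: ('a \<times> 'b) measure). snd p \<notin> N"
  proof (rule AE_lborel_pairI)
    show "Measurable.pred (borel \<Otimes>\<^sub>M borel) (\<lambda>p::'a \<times> 'b. snd p \<notin> N)"
      using N(3) by measurable
    show "AE x in lborel. AE y in lborel. snd (x :: 'a, y) \<notin> N"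
      using N by (simp add: AE_not_in null_setsI)
  qed
  then show ?thesis
    by eventually_elim (use N(1) in auto)
qed

lemma
  fixes f g :: "'a \<Rightarrow> 'b::{banach, second_countable_topology}"
  assumes "set_borel_measurable M A f" "set_borel_measurable M A g"
    and AE_eq: "AE x in M. x \<in> A \<longrightarrow> f x = g x"
  shows set_integrable_cong_AE_on: "set_integrable M A f \<longleftrightarrow> set_integrable M A g"
    and set_lebesgue_integral_cong_AE_on: "(LINT x:A|M. f x) = (LINT x:A|M. g x)"
proof -
  have "AE x in M. indicat_real A x *\<^sub>R f x = indicat_real A x *\<^sub>R g x"
    using AE_eq by eventually_elim (auto simp: indicator_def)
  note cong = assms(1,2)[unfolded set_borel_measurable_def] this
  show "set_integrable M A f \<longleftrightarrow> set_integrable M A g"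
    unfolding set_integrable_def by (rule integrable_cong_AE[OF cong])
  show "(LINT x:A|M. f x) = (LINT x:A|M. g x)"
    unfolding set_lebesgue_integral_def by (rule integral_cong_AE[OF cong])
qed

lemma
  fixes k :: "'a \<Rightarrow> ennreal"
  assumes [measurable]: "k \<in> borel_measurable M" and finite: "(\<integral>\<^sup>+x. k x \<partial>M) < \<infinity>"
  shows AE_ennreal_enn2real_eq: "AE x in M. ennreal (enn2real (k x)) = k x"
    and integrable_enn2real: "integrable M (\<lambda>x. enn2real (k x))"
proof -
  have "AE x in M. k x \<noteq> \<infinity>"
    using finite by (intro nn_integral_PInf_AE) auto
  then show AE_eq: "AE x in M. ennreal (enn2real (k x)) = k x"
    by eventually_elim (simp add: less_top)
  show "integrable M (\<lambda>x. enn2real (k x))"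
    using finite nn_integral_cong_AE[OF AE_eq] by (intro integrableI_nonneg) auto
qed

lemma integral_dominated_convergence_ennreal:
  fixes f :: "nat \<Rightarrow> 'a \<Rightarrow> 'b::{banach, second_countable_topology}" and k :: "'a \<Rightarrow> ennreal"
  assumes [measurable]: "\<And>n. f n \<in> borel_measurable M" "g \<in> borel_measurable M" "k \<in> borel_measurable M"
    and lim: "AE x in M. (\<lambda>n. f n x) \<longlonglongrightarrow> g x"
    and bound: "\<And>n. AE x in M. ennreal (norm (f n x)) \<le> k x"
    and finite: "(\<integral>\<^sup>+x. k x \<partial>M) < \<infinity>"
  shows "(\<lambda>n. \<integral>x. f n x \<partial>M) \<longlonglongrightarrow> (\<integral>x. g x \<partial>M)"
proof (rule integral_dominated_convergence)
  show "integrable M (\<lambda>x. enn2real (k x))"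
    using finite by (intro integrable_enn2real) measurable
  show "AE x in M. norm (f n x) \<le> enn2real (k x)" for n
    using AE_ennreal_enn2real_eq[OF assms(3) finite] bound[of n]
  proof eventually_elim
    case (elim x)
    then have "ennreal (norm (f n x)) \<le> ennreal (enn2real (k x))" by simp
    then show ?case by (subst (asm) ennreal_le_iff) simp_all
  qed
qed (use lim in measurable)

lemma tendsto_floor_multiple_divide:
  fixes t :: real
  shows "(\<lambda>n. of_int \<lfloor>real (Suc n) * t\<rfloor> / real (Suc n)) \<longlonglongrightarrow> t"
proof (rule LIM_zero_cancel, rule Lim_null_comparison)
  show "\<forall>\<^sub>F n in sequentially. norm (of_int \<lfloor>real (Suc n) * t\<rfloor> / real (Suc n) - t) \<le> 1 / real (Suc n)"
  proof (intro always_eventually allI)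
    fix n
    have "of_int \<lfloor>real (Suc n) * t\<rfloor> / real (Suc n) - t
        = (of_int \<lfloor>real (Suc n) * t\<rfloor> - real (Suc n) * t) / real (Suc n)"
      by (simp add: diff_divide_distrib del: of_nat_Suc)
    moreover have "\<bar>of_int \<lfloor>real (Suc n) * t\<rfloor> - real (Suc n) * t\<bar> \<le> 1" by linarith
    ultimately show "norm (of_int \<lfloor>real (Suc n) * t\<rfloor> / real (Suc n) - t) \<le> 1 / real (Suc n)"
      by (simp add: divide_right_mono del: of_nat_Suc)
  qed
  show "(\<lambda>n. 1 / real (Suc n)) \<longlonglongrightarrow> 0"
    by (rule LIMSEQ_Suc[OF lim_const_over_n])
qed

lemma jointly_measurable_modification:
  fixes w R :: "real \<Rightarrow> 'a \<Rightarrow> 'b::{banach, second_countable_topology}"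
  assumes "T \<ge> 0"
    and w: "\<And>t. t \<in> {0..T} \<Longrightarrow> w t \<in> borel_measurable M"
    and eq: "\<And>t. t \<in> {0..T} \<Longrightarrow> AE x in M. w t x = R t x"
    and cont: "AE x in M. continuous_on {0..T} (\<lambda>t. R t x)"
  obtains v where "case_prod v \<in> borel_measurable (borel \<Otimes>\<^sub>M M)"
    and "AE x in M. \<forall>t\<in>{0..T}. v t x = R t x"
proof
  define grid :: "nat \<Rightarrow> int \<Rightarrow> real" where "grid n k = max 0 (min T (of_int k / real (Suc n)))" for n k
  have grid_mem: "grid n k \<in> {0..T}" for n k using \<open>T \<ge> 0\<close> by (auto simp: grid_def)
  let ?step = "\<lambda>n t. grid n \<lfloor>real (Suc n) * t\<rfloor>"
  define v where "v t x = lim (\<lambda>n. w (?step n t) x)" for t x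
  have "(\<lambda>p. w (?step n (fst p)) (snd p)) \<in> borel_measurable (borel \<Otimes>\<^sub>M M)" for n
  proof (rule measurable_compose_countable[where f = "\<lambda>k p. w (grid n k) (snd p)"])
    show "(\<lambda>p. w (grid n k) (snd p)) \<in> borel_measurable (borel \<Otimes>\<^sub>M M)" for k
      by (rule measurable_compose[OF measurable_snd w[OF grid_mem]])
  qed measurable
  then show "case_prod v \<in> borel_measurable (borel \<Otimes>\<^sub>M M)"
    unfolding v_def case_prod_beta' by (intro borel_measurable_lim_metric)
  have "AE x in M. \<forall>n k. w (grid n k) x = R (grid n k) x"
    unfolding AE_all_countable using eq[OF grid_mem] by blast
  then show "AE x in M. \<forall>t\<in>{0..T}. v t x = R t x"
    using cont
  proof (eventually_elim, intro ballI)
    fix x t assume eq_grid: "\<forall>n k. w (grid n k) x = R (grid n k) x"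
      and cont: "continuous_on {0..T} (\<lambda>t. R t x)" and t: "t \<in> {0..T}"
    have "(\<lambda>n. ?step n t) \<longlonglongrightarrow> max 0 (min T t)"
      unfolding grid_def by (intro tendsto_max tendsto_min tendsto_const tendsto_floor_multiple_divide)
    then have "(\<lambda>n. R (?step n t) x) \<longlonglongrightarrow> R t x"
      using t grid_mem by (intro continuous_on_tendsto_compose[OF cont]) auto
    then show "v t x = R t x" unfolding v_def using eq_grid by (simp add: limI)
  qed
qed

subsection \<open>Integrals depending on time\<close>

lemma continuous_on_integral_sublevel:
  fixes f :: "'a \<Rightarrow> 'b::{banach, second_countable_topology}" and g :: "'a \<Rightarrow> real"
  assumes f: "integrable M f" and [measurable]: "g \<in> borel_measurable M"
    and null: "\<And>t. AE x in M. g x \<noteq> t"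
  shows "continuous_on UNIV (\<lambda>t. \<integral>x. indicat_real {..t} (g x) *\<^sub>R f x \<partial>M)"
proof (rule continuous_on_sequentiallyI)
  fix X :: "nat \<Rightarrow> real" and t assume X: "X \<longlonglongrightarrow> t"
  note [measurable] = borel_measurable_integrable[OF f]
  show "(\<lambda>n. \<integral>x. indicat_real {..X n} (g x) *\<^sub>R f x \<partial>M) \<longlonglongrightarrow> (\<integral>x. indicat_real {..t} (g x) *\<^sub>R f x \<partial>M)"
  proof (rule integral_dominated_convergence)
    show "AE x in M. (\<lambda>n. indicat_real {..X n} (g x) *\<^sub>R f x) \<longlonglongrightarrow> indicat_real {..t} (g x) *\<^sub>R f x"
      using null[of t]
    proof eventually_elim
      case (elim x)
      then consider "g x < t" | "t < g x" by linarith
      then have "\<forall>\<^sub>F n in sequentially. (g x \<le> X n) = (g x \<le> t)"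
      proof cases
        case 1
        from order_tendstoD(1)[OF X this] show ?thesis
          by eventually_elim (use 1 in auto)
      next
        case 2
        from order_tendstoD(2)[OF X this] show ?thesis
          by eventually_elim (use 2 in auto)
      qed
      then have "\<forall>\<^sub>F n in sequentially. indicat_real {..X n} (g x) *\<^sub>R f x
          = indicat_real {..t} (g x) *\<^sub>R f x"
        by eventually_elim (simp add: indicator_def)
      then show ?case by (rule tendsto_eventually)
    qed
    show "AE x in M. norm (indicat_real {..X n} (g x) *\<^sub>R f x) \<le> norm (f x)" for n
      by (simp add: indicator_def)
  qed (use f in auto)
qed

abbreviation strip :: "real \<Rightarrow> (real \<times> 'a) set" where
  "strip t \<equiv> {0..t} \<times> UNIV"

lemma sets_strip [measurable, simp]:
  "(strip t :: (real \<times> 'a::topological_space) set) \<in> sets borel"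
  by (intro borel_closed closed_Times) auto

lemma set_borel_measurable_strip:
  fixes f :: "real \<times> 'b::euclidean_space \<Rightarrow> 'c::{real_normed_vector, second_countable_topology}"
  assumes "f \<in> borel_measurable (borel \<Otimes>\<^sub>M borel)"
  shows "set_borel_measurable lborel (strip t) f"
  unfolding set_borel_measurable_def
  by (rule borel_measurable_scaleR[OF borel_measurable_indicator
      borel_measurable_lborel_prodI[OF assms]]) simp

lemma continuous_on_integral_strip:
  fixes J :: "real \<times> 'b::euclidean_space \<Rightarrow> 'c::{banach, second_countable_topology}"
  assumes J: "set_integrable lborel (strip T) J"
  shows "continuous_on {0..T} (\<lambda>t. LINT p : strip t | lborel. J p)"
proof -
  let ?I = "\<lambda>t. \<integral>p. indicat_real {..t} (fst p) *\<^sub>R (indicat_real (strip T) p *\<^sub>R J p) \<partial>lborel"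
  have "continuous_on UNIV ?I"
  proof (rule continuous_on_integral_sublevel)
    show "integrable lborel (\<lambda>p. indicat_real (strip T) p *\<^sub>R J p)"
      using J by (simp add: set_integrable_def)
    show "AE p in (lborel :: (real \<times> 'b) measure). fst p \<noteq> t" for t
    proof (rule AE_lborel_pairI)
      show "AE x in lborel. AE y in (lborel :: 'b measure). fst (x, y) \<noteq> t"
        using AE_lborel_singleton[of t] by eventually_elim simp
    qed simp
  qed (rule borel_measurable_lborel_prodI[OF measurable_fst])
  then have "continuous_on {0..T} ?I" by (rule continuous_on_subset) simp
  then show ?thesis
    by (rule continuous_on_eq)
      (auto simp: set_lebesgue_integral_def indicator_def intro!: Bochner_Integration.integral_cong)
qed

lemma nn_integral_small_on_short_intervals:
  fixes f :: "real \<Rightarrow> ennreal"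
  assumes [measurable]: "f \<in> borel_measurable borel"
    and finite: "(\<integral>\<^sup>+t\<in>{0..T}. f t \<partial>lborel) < \<infinity>" and "\<epsilon> > 0"
  obtains \<delta> where "\<delta> > 0"
    and "\<And>x y. 0 \<le> x \<Longrightarrow> x \<le> y \<Longrightarrow> y \<le> T \<Longrightarrow> y - x < \<delta> \<Longrightarrow> (\<integral>\<^sup>+t\<in>{x..y}. f t \<partial>lborel) < ennreal \<epsilon>"
proof -
  define r where "r t = enn2real (f t * indicator {0..T} t)" for t
  have "(\<lambda>t. f t * indicator {0..T} t) \<in> borel_measurable lborel" by measurable
  note AE_r = AE_ennreal_enn2real_eq[OF this finite, folded r_def]
    and r_int = integrable_enn2real[OF this finite, folded r_def]
  define G where "G t = (\<integral>s. indicat_real {..t} s *\<^sub>R r s \<partial>lborel)" for t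
  have "continuous_on UNIV G"
    unfolding G_def
    by (rule continuous_on_integral_sublevel[OF r_int]) (simp_all add: AE_lborel_singleton)
  then have "uniformly_continuous_on {0..T} G"
    by (intro compact_uniformly_continuous) (auto intro: continuous_on_subset)
  then obtain \<delta> where "\<delta> > 0"
    and \<delta>: "\<And>x y. x \<in> {0..T} \<Longrightarrow> y \<in> {0..T} \<Longrightarrow> dist y x < \<delta> \<Longrightarrow> dist (G y) (G x) < \<epsilon>"
    using \<open>\<epsilon> > 0\<close> unfolding uniformly_continuous_on_def by metis
  have "(\<integral>\<^sup>+t\<in>{x..y}. f t \<partial>lborel) < ennreal \<epsilon>" if xy: "0 \<le> x" "x \<le> y" "y \<le> T" "y - x < \<delta>" for x y
  proof -
    have integrable_r: "integrable lborel (\<lambda>s. indicat_real {..t} s *\<^sub>R r s)" for t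
      by (rule integrable_mult_indicator[OF _ r_int]) simp
    have "(\<integral>\<^sup>+t\<in>{x..y}. f t \<partial>lborel)
        = (\<integral>\<^sup>+t. ennreal (indicat_real {..y} t *\<^sub>R r t - indicat_real {..x} t *\<^sub>R r t) \<partial>lborel)"
      using AE_r AE_lborel_singleton[of x]
      by (intro nn_integral_cong_AE, eventually_elim)
        (use xy in \<open>auto simp: indicator_def split: if_splits\<close>)
    also have "\<dots> = ennreal (G y - G x)"
      using xy unfolding G_def Bochner_Integration.integral_diff[OF integrable_r integrable_r, symmetric]
      by (intro nn_integral_eq_integral Bochner_Integration.integrable_diff integrable_r)
        (auto simp: indicator_def r_def)
    also have "\<dots> < ennreal \<epsilon>"
      using \<delta>[of x y] xy \<open>\<epsilon> > 0\<close> by (intro ennreal_lessI) (auto simp: dist_real_def)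
    finally show ?thesis .
  qed
  with \<open>\<delta> > 0\<close> show ?thesis by (rule that)
qed

lemma interval_induct_uniform_step:
  fixes T \<delta> :: real
  assumes "T \<ge> 0" "\<delta> > 0" and base: "P 0"
    and step: "\<And>x y. P x \<Longrightarrow> 0 \<le> x \<Longrightarrow> x \<le> y \<Longrightarrow> y \<le> T \<Longrightarrow> y - x \<le> \<delta> \<Longrightarrow> P y"
  shows "P T"
proof -
  have "P (min T (real n * \<delta>))" for n
  proof (induction n)
    case 0
    show ?case using base \<open>T \<ge> 0\<close> by simp
  next
    case (Suc n)
    have "real (Suc n) * \<delta> = real n * \<delta> + \<delta>" by (simp add: algebra_simps)
    then show ?case
      using \<open>T \<ge> 0\<close> \<open>\<delta> > 0\<close> by (intro step[OF Suc]) auto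
  qed
  moreover obtain n where "T \<le> real n * \<delta>"
    using ex_less_of_nat_mult[OF \<open>\<delta> > 0\<close>, of T] by (auto intro: less_imp_le)
  ultimately show ?thesis by (metis min_def)
qed

lemma gronwall_L2_step:
  fixes D g :: "real \<Rightarrow> ennreal"
  assumes [measurable]: "D \<in> borel_measurable borel" "g \<in> borel_measurable borel"
    and "0 \<le> x" "x \<le> y"
    and vanish: "(\<integral>\<^sup>+t\<in>{0..x}. g t * D t \<partial>lborel) = 0"
    and finite: "(\<integral>\<^sup>+t\<in>{0..y}. g t * D t \<partial>lborel) < \<infinity>"
    and small: "(\<integral>\<^sup>+t\<in>{x..y}. (g t)\<^sup>2 \<partial>lborel) * K < 1"
    and estimate: "(\<integral>\<^sup>+t\<in>{0..y}. (D t)\<^sup>2 \<partial>lborel) \<le> K * (\<integral>\<^sup>+t\<in>{0..y}. g t * D t \<partial>lborel)\<^sup>2"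
  shows "(\<integral>\<^sup>+t\<in>{0..y}. g t * D t \<partial>lborel) = 0"
proof -
  let ?h = "\<integral>\<^sup>+t\<in>{0..y}. g t * D t \<partial>lborel"
  have indicator_power2: "(indicator A t :: ennreal)\<^sup>2 = indicator A t" for A and t :: real
    by (simp add: indicator_def)
  have "AE t in lborel. g t * D t * indicator {0..x} t = 0"
    using vanish by (simp add: nn_integral_0_iff_AE)
  then have "AE t in lborel. g t * D t * indicator {0..y} t
      = (g t * indicator {x..y} t) * (D t * indicator {0..y} t)"
  proof eventually_elim
    case (elim t)
    then show ?case using \<open>0 \<le> x\<close> \<open>x \<le> y\<close>
      by (cases "t \<le> x") (simp_all add: indicator_def, blast)
  qed
  then have "?h = (\<integral>\<^sup>+t. (g t * indicator {x..y} t) * (D t * indicator {0..y} t) \<partial>lborel)"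
    by (rule nn_integral_cong_AE)
  then have "?h\<^sup>2
      \<le> (\<integral>\<^sup>+t. (g t * indicator {x..y} t)\<^sup>2 \<partial>lborel) * (\<integral>\<^sup>+t. (D t * indicator {0..y} t)\<^sup>2 \<partial>lborel)"
    by (simp only:) (rule Cauchy_Schwarz_nn_integral; measurable)
  also have "\<dots> = (\<integral>\<^sup>+t\<in>{x..y}. (g t)\<^sup>2 \<partial>lborel) * (\<integral>\<^sup>+t\<in>{0..y}. (D t)\<^sup>2 \<partial>lborel)"
    by (simp only: power_mult_distrib indicator_power2)
  also have "\<dots> \<le> (\<integral>\<^sup>+t\<in>{x..y}. (g t)\<^sup>2 \<partial>lborel) * (K * ?h\<^sup>2)"
    by (intro mult_left_mono estimate) simp
  finally have "?h\<^sup>2 \<le> ((\<integral>\<^sup>+t\<in>{x..y}. (g t)\<^sup>2 \<partial>lborel) * K) * ?h\<^sup>2"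
    by (simp only: mult.assoc)
  from ennreal_eq_0_if_le_mult_self[OF this small] finite show ?thesis
    by (simp add: power2_eq_square ennreal_mult_less_top)
qed

lemma gronwall_L2:
  fixes D g :: "real \<Rightarrow> ennreal"
  assumes [measurable]: "D \<in> borel_measurable borel" "g \<in> borel_measurable borel"
    and "T \<ge> 0" and "K > 0"
    and g_L2: "(\<integral>\<^sup>+t\<in>{0..T}. (g t)\<^sup>2 \<partial>lborel) < \<infinity>"
    and D_le: "\<And>t. D t \<le> g t"
    and estimate: "\<And>\<tau>. 0 \<le> \<tau> \<Longrightarrow> \<tau> \<le> T \<Longrightarrow>
       (\<integral>\<^sup>+t\<in>{0..\<tau>}. (D t)\<^sup>2 \<partial>lborel) \<le> ennreal K * (\<integral>\<^sup>+t\<in>{0..\<tau>}. g t * D t \<partial>lborel)\<^sup>2"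
  shows "(\<integral>\<^sup>+t\<in>{0..T}. g t * D t \<partial>lborel) = 0"
proof -
  have "1 / K > 0" using \<open>K > 0\<close> by simp
  from nn_integral_small_on_short_intervals[OF _ g_L2 this]
  obtain \<delta> where "\<delta> > 0" and \<delta>: "\<And>x y. 0 \<le> x \<Longrightarrow> x \<le> y \<Longrightarrow> y \<le> T \<Longrightarrow> y - x < \<delta>
      \<Longrightarrow> (\<integral>\<^sup>+t\<in>{x..y}. (g t)\<^sup>2 \<partial>lborel) < ennreal (1 / K)"
    by auto
  show ?thesis
  proof (rule interval_induct_uniform_step[where \<delta> = "\<delta> / 2"])
    show "(\<integral>\<^sup>+t\<in>{0..0}. g t * D t \<partial>lborel) = 0"
      by (simp add: nn_integral_null_set finite_imp_null_set_lborel)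
  next
    fix x y assume xy: "0 \<le> x" "x \<le> y" "y \<le> T" "y - x \<le> \<delta> / 2"
      and vanish: "(\<integral>\<^sup>+t\<in>{0..x}. g t * D t \<partial>lborel) = 0"
    show "(\<integral>\<^sup>+t\<in>{0..y}. g t * D t \<partial>lborel) = 0"
    proof (rule gronwall_L2_step[OF _ _ xy(1,2) vanish])
      have "(\<integral>\<^sup>+t\<in>{0..y}. g t * D t \<partial>lborel) \<le> (\<integral>\<^sup>+t\<in>{0..T}. (g t)\<^sup>2 \<partial>lborel)"
        using xy D_le
        by (intro nn_integral_mono) (auto simp: power2_eq_square mult_left_mono split: split_indicator)
      then show "(\<integral>\<^sup>+t\<in>{0..y}. g t * D t \<partial>lborel) < \<infinity>" using g_L2 by (rule order.strict_trans1)
      have "(\<integral>\<^sup>+t\<in>{x..y}. (g t)\<^sup>2 \<partial>lborel) * ennreal K < ennreal (1 / K) * ennreal K"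
        using \<delta>[of x y] xy \<open>\<delta> > 0\<close> \<open>K > 0\<close> by (intro ennreal_mult_strict_right_mono) auto
      also have "\<dots> = 1" using \<open>K > 0\<close> by (simp flip: ennreal_mult)
      finally show "(\<integral>\<^sup>+t\<in>{x..y}. (g t)\<^sup>2 \<partial>lborel) * ennreal K < 1" .
    qed (use xy in \<open>auto intro: estimate\<close>)
  qed (use \<open>T \<ge> 0\<close> \<open>\<delta> > 0\<close> in auto)
qed

subsection \<open>Weighted \<open>L\<^sup>1\<close> norms\<close>

definition weighted_norm :: "('a::euclidean_space \<Rightarrow> real) \<Rightarrow> ('a \<Rightarrow> ennreal) \<Rightarrow> ennreal" where
  "weighted_norm w f = (\<integral>\<^sup>+\<xi>. ennreal (w \<xi>) * f \<xi> \<partial>lborel)"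

lemma measurable_weighted_norm [measurable (raw)]:
  assumes [measurable]: "w \<in> borel_measurable borel" "case_prod h \<in> borel_measurable (M \<Otimes>\<^sub>M borel)"
  shows "(\<lambda>t. weighted_norm w (h t)) \<in> borel_measurable M"
  unfolding weighted_norm_def by measurable

lemma weighted_norm_mono_AE:
  "(AE \<xi> in lborel. f \<xi> \<le> g \<xi>) \<Longrightarrow> weighted_norm w f \<le> weighted_norm w g"
  unfolding weighted_norm_def
  by (intro nn_integral_mono_AE) (auto elim!: eventually_mono intro: mult_left_mono)

lemma weighted_norm_cong_AE:
  "(AE \<xi> in lborel. f \<xi> = g \<xi>) \<Longrightarrow> weighted_norm w f = weighted_norm w g"
  unfolding weighted_norm_def by (intro nn_integral_cong_AE) (auto elim!: eventually_mono)

lemma weighted_norm_zero [simp]: "weighted_norm w (\<lambda>_. 0) = 0"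
  by (simp add: weighted_norm_def)

lemma weighted_norm_add:
  assumes [measurable]: "w \<in> borel_measurable borel" "f \<in> borel_measurable borel"
      "g \<in> borel_measurable borel"
  shows "weighted_norm w (\<lambda>\<xi>. f \<xi> + g \<xi>) = weighted_norm w f + weighted_norm w g"
  unfolding weighted_norm_def by (simp add: distrib_left nn_integral_add)

lemma weighted_norm_cmult:
  assumes [measurable]: "w \<in> borel_measurable borel" "f \<in> borel_measurable borel"
  shows "weighted_norm w (\<lambda>\<xi>. c * f \<xi>) = c * weighted_norm w f"
  unfolding weighted_norm_def by (simp add: mult.left_commute[of _ c] nn_integral_cmult)

lemma weighted_norm_mult_ennreal:
  assumes "\<And>\<xi>. w \<xi> \<ge> 0" "\<And>\<xi>. r \<xi> \<ge> 0"
  shows "weighted_norm w (\<lambda>\<xi>. ennreal (r \<xi>) * f \<xi>) = weighted_norm (\<lambda>\<xi>. r \<xi> * w \<xi>) f"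
  unfolding weighted_norm_def by (simp add: assms ennreal_mult mult_ac)

lemma weighted_norm_nn_integral:
  fixes h :: "'b::euclidean_space \<Rightarrow> 'a::euclidean_space \<Rightarrow> ennreal"
  assumes [measurable]: "w \<in> borel_measurable borel" "jointly_measurable h" "A \<in> sets borel"
  shows "weighted_norm w (\<lambda>\<xi>. \<integral>\<^sup>+t\<in>A. h t \<xi> \<partial>lborel) = (\<integral>\<^sup>+t\<in>A. weighted_norm w (h t) \<partial>lborel)"
proof -
  have "weighted_norm w (\<lambda>\<xi>. \<integral>\<^sup>+t\<in>A. h t \<xi> \<partial>lborel)
      = (\<integral>\<^sup>+\<xi>. \<integral>\<^sup>+t. ennreal (w \<xi>) * h t \<xi> * indicator A t \<partial>lborel \<partial>lborel)"
    unfolding weighted_norm_def by (simp add: nn_integral_cmult mult.assoc)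
  also have "\<dots> = (\<integral>\<^sup>+t. \<integral>\<^sup>+\<xi>. ennreal (w \<xi>) * h t \<xi> * indicator A t \<partial>lborel \<partial>lborel)"
    by (rule nn_integral_lborel_commute) measurable
  also have "\<dots> = (\<integral>\<^sup>+t\<in>A. weighted_norm w (h t) \<partial>lborel)"
    unfolding weighted_norm_def by (simp add: nn_integral_multc)
  finally show ?thesis .
qed

lemma AE_finite_if_weighted_norm_finite:
  assumes [measurable]: "w \<in> borel_measurable borel" "f \<in> borel_measurable borel"
    and pos: "AE \<xi> in lborel. w \<xi> > 0" and finite: "weighted_norm w f < \<infinity>"
  shows "AE \<xi> in lborel. f \<xi> < \<infinity>"
proof -
  have "AE \<xi> in lborel. ennreal (w \<xi>) * f \<xi> \<noteq> \<infinity>"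
    using finite unfolding weighted_norm_def by (intro nn_integral_PInf_AE) auto
  with pos show ?thesis
    by eventually_elim (auto simp: ennreal_mult_eq_top_iff less_top)
qed

lemma AE_zero_if_weighted_norm_zero:
  assumes [measurable]: "w \<in> borel_measurable borel" "f \<in> borel_measurable borel"
    and pos: "AE \<xi> in lborel. w \<xi> > 0" and zero: "weighted_norm w f = 0"
  shows "AE \<xi> in lborel. f \<xi> = 0"
proof -
  have "AE \<xi> in lborel. ennreal (w \<xi>) * f \<xi> = 0"
    using zero unfolding weighted_norm_def by (simp add: nn_integral_0_iff_AE)
  with pos show ?thesis
    by eventually_elim auto
qed

lemma weighted_norm_tendsto_zero_dominated:
  assumes [measurable]: "w \<in> borel_measurable borel" "\<And>i. f i \<in> borel_measurable borel"
      "D \<in> borel_measurable borel"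
    and dominated: "\<And>i. AE \<xi> in lborel. f i \<xi> \<le> D \<xi>" and finite: "weighted_norm w D < \<infinity>"
    and lim: "AE \<xi> in lborel. (\<lambda>i. f i \<xi>) \<longlonglongrightarrow> 0"
  shows "(\<lambda>i. weighted_norm w (f i)) \<longlonglongrightarrow> 0"
proof -
  have "(\<lambda>i. weighted_norm w (f i)) \<longlonglongrightarrow> weighted_norm w (\<lambda>_. 0)"
    unfolding weighted_norm_def
  proof (rule nn_integral_dominated_convergence)
    show "(\<integral>\<^sup>+\<xi>. ennreal (w \<xi>) * D \<xi> \<partial>lborel) < \<infinity>"
      using finite by (simp add: weighted_norm_def)
    show "AE \<xi> in lborel. ennreal (w \<xi>) * f i \<xi> \<le> ennreal (w \<xi>) * D \<xi>" for i
      using dominated[of i] by eventually_elim (simp add: mult_left_mono)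
    show "AE \<xi> in lborel. (\<lambda>i. ennreal (w \<xi>) * f i \<xi>) \<longlonglongrightarrow> ennreal (w \<xi>) * 0"
      using lim by eventually_elim (intro ennreal_tendsto_cmult, simp_all)
  qed measurable
  then show ?thesis by simp
qed

lemma weighted_norm_interpolation:
  assumes [measurable]: "w \<in> borel_measurable borel" "f \<in> borel_measurable borel"
    and w: "\<And>\<xi>. w \<xi> \<ge> 0"
  shows "(weighted_norm (\<lambda>\<xi>. norm \<xi> * w \<xi>) f)\<^sup>2
      \<le> weighted_norm w f * weighted_norm (\<lambda>\<xi>. (norm \<xi>)\<^sup>2 * w \<xi>) f"
proof -
  define \<mu> where "\<mu> = density lborel (\<lambda>\<xi>. ennreal (w \<xi>) * f \<xi>)"
  have [measurable_cong]: "sets \<mu> = sets borel" by (simp add: \<mu>_def)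
  have weighted: "(\<integral>\<^sup>+\<xi>. ennreal (r \<xi>) \<partial>\<mu>) = weighted_norm (\<lambda>\<xi>. r \<xi> * w \<xi>) f"
    if [measurable]: "r \<in> borel_measurable borel" and "\<And>\<xi>. r \<xi> \<ge> 0" for r
    unfolding \<mu>_def weighted_norm_def using w that(2)
    by (simp add: nn_integral_density ennreal_mult mult_ac)
  have "(\<integral>\<^sup>+\<xi>. ennreal 1 * ennreal (norm \<xi>) \<partial>\<mu>)\<^sup>2
      \<le> (\<integral>\<^sup>+\<xi>. (ennreal 1)\<^sup>2 \<partial>\<mu>) * (\<integral>\<^sup>+\<xi>. (ennreal (norm \<xi>))\<^sup>2 \<partial>\<mu>)"
    by (rule Cauchy_Schwarz_nn_integral) measurable
  then show ?thesis
    using weighted[of norm] weighted[of "\<lambda>_. 1"] weighted[of "\<lambda>\<xi>. (norm \<xi>)\<^sup>2"]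
    by (simp add: ennreal_power)
qed

lemma nn_integral_weighted_norm_interpolation:
  fixes f :: "real \<Rightarrow> 'a::euclidean_space \<Rightarrow> ennreal"
  assumes [measurable]: "w \<in> borel_measurable borel" "jointly_measurable f" and w: "\<And>\<xi>. w \<xi> \<ge> 0"
    and bound: "\<And>t. t \<in> {0..T} \<Longrightarrow> weighted_norm w (f t) \<le> A"
  shows "(\<integral>\<^sup>+t\<in>{0..T}. (weighted_norm (\<lambda>\<xi>. norm \<xi> * w \<xi>) (f t))\<^sup>2 \<partial>lborel)
    \<le> A * (\<integral>\<^sup>+t\<in>{0..T}. weighted_norm (\<lambda>\<xi>. (norm \<xi>)\<^sup>2 * w \<xi>) (f t) \<partial>lborel)"
proof -
  let ?N1 = "\<lambda>t. weighted_norm (\<lambda>\<xi>. norm \<xi> * w \<xi>) (f t)"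
  let ?N2 = "\<lambda>t. weighted_norm (\<lambda>\<xi>. (norm \<xi>)\<^sup>2 * w \<xi>) (f t)"
  have "(?N1 t)\<^sup>2 \<le> A * ?N2 t" if "t \<in> {0..T}" for t
  proof -
    have "(?N1 t)\<^sup>2 \<le> weighted_norm w (f t) * ?N2 t"
      by (rule weighted_norm_interpolation[OF _ _ w]) measurable
    also have "\<dots> \<le> A * ?N2 t" by (intro mult_right_mono bound that) simp
    finally show ?thesis .
  qed
  then have "(\<integral>\<^sup>+t\<in>{0..T}. (?N1 t)\<^sup>2 \<partial>lborel) \<le> (\<integral>\<^sup>+t. A * (?N2 t * indicator {0..T} t) \<partial>lborel)"
    by (intro nn_integral_mono) (auto split: split_indicator)
  also have "\<dots> = A * (\<integral>\<^sup>+t\<in>{0..T}. ?N2 t \<partial>lborel)"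
    by (rule nn_integral_cmult) measurable
  finally show ?thesis .
qed

subsection \<open>Convolution\<close>

definition convolution :: "('a::euclidean_space \<Rightarrow> ennreal) \<Rightarrow> ('a \<Rightarrow> ennreal) \<Rightarrow> 'a \<Rightarrow> ennreal" where
  "convolution f g \<xi> = (\<integral>\<^sup>+\<eta>. f (\<xi> - \<eta>) * g \<eta> \<partial>lborel)"

lemma measurable_convolution [measurable (raw)]:
  assumes [measurable]: "case_prod m \<in> borel_measurable (M \<Otimes>\<^sub>M borel)"
    "case_prod n \<in> borel_measurable (M \<Otimes>\<^sub>M borel)" "f \<in> borel_measurable M"
  shows "(\<lambda>x. convolution (m x) (n x) (f x)) \<in> borel_measurable M"
  unfolding convolution_def by measurable

lemma convolution_mono:
  "(\<And>\<eta>. f \<eta> \<le> f' \<eta>) \<Longrightarrow> (\<And>\<eta>. g \<eta> \<le> g' \<eta>) \<Longrightarrow> convolution f g \<xi> \<le> convolution f' g' \<xi>"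
  unfolding convolution_def by (intro nn_integral_mono mult_mono) auto

lemma
  assumes [measurable]: "f \<in> borel_measurable borel" "f' \<in> borel_measurable borel"
      "g \<in> borel_measurable borel"
  shows convolution_add_left: "convolution (\<lambda>\<eta>. f \<eta> + f' \<eta>) g \<xi> = convolution f g \<xi> + convolution f' g \<xi>"
    and convolution_add_right: "convolution g (\<lambda>\<eta>. f \<eta> + f' \<eta>) \<xi>
        = convolution g f \<xi> + convolution g f' \<xi>"
  unfolding convolution_def by (simp_all add: distrib_left distrib_right nn_integral_add)

lemma weighted_norm_convolution_le:
  assumes [measurable]: "w \<in> borel_measurable borel" "f \<in> borel_measurable borel"
      "g \<in> borel_measurable borel"
    and w: "\<And>\<xi>. w \<xi> \<ge> 0" and submult: "\<And>\<xi> \<eta>. w \<xi> \<le> w (\<xi> - \<eta>) * w \<eta>"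
  shows "weighted_norm w (convolution f g) \<le> weighted_norm w f * weighted_norm w g"
proof -
  let ?F = "\<lambda>\<xi>. ennreal (w \<xi>) * f \<xi>" and ?G = "\<lambda>\<xi>. ennreal (w \<xi>) * g \<xi>"
  have "weighted_norm w (convolution f g)
      = (\<integral>\<^sup>+\<xi>. \<integral>\<^sup>+\<eta>. ennreal (w \<xi>) * (f (\<xi> - \<eta>) * g \<eta>) \<partial>lborel \<partial>lborel)"
    unfolding weighted_norm_def convolution_def by (simp add: nn_integral_cmult)
  also have "\<dots> \<le> (\<integral>\<^sup>+\<xi>. \<integral>\<^sup>+\<eta>. ?F (\<xi> - \<eta>) * ?G \<eta> \<partial>lborel \<partial>lborel)"
  proof (intro nn_integral_mono)
    fix \<xi> \<eta>
    have "ennreal (w \<xi>) * (f (\<xi> - \<eta>) * g \<eta>) \<le> ennreal (w (\<xi> - \<eta>) * w \<eta>) * (f (\<xi> - \<eta>) * g \<eta>)"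
      by (intro mult_right_mono ennreal_leI submult) simp
    then show "ennreal (w \<xi>) * (f (\<xi> - \<eta>) * g \<eta>) \<le> ?F (\<xi> - \<eta>) * ?G \<eta>"
      using w by (simp add: ennreal_mult mult_ac)
  qed
  also have "\<dots> = (\<integral>\<^sup>+\<eta>. \<integral>\<^sup>+\<xi>. ?F (\<xi> - \<eta>) * ?G \<eta> \<partial>lborel \<partial>lborel)"
    by (rule nn_integral_lborel_commute) measurable
  also have "\<dots> = (\<integral>\<^sup>+\<eta>. (\<integral>\<^sup>+\<xi>. ?F (\<xi> - \<eta>) \<partial>lborel) * ?G \<eta> \<partial>lborel)"
    by (intro nn_integral_cong nn_integral_multc) measurable
  also have "\<dots> = (\<integral>\<^sup>+\<eta>. weighted_norm w f * ?G \<eta> \<partial>lborel)"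
    unfolding weighted_norm_def by (subst nn_integral_lborel_minus_const[where f = ?F]) simp_all
  also have "\<dots> = weighted_norm w f * weighted_norm w g"
    unfolding weighted_norm_def by (intro nn_integral_cmult) measurable
  finally show ?thesis .
qed

subsection \<open>The heat semigroup\<close>

lemma nn_integral_exp_decay_le:
  fixes \<nu> r s T :: real
  assumes "\<nu> > 0" "r \<ge> 0"
  shows "ennreal r * (\<integral>\<^sup>+t\<in>{s..T}. ennreal (exp (- \<nu> * (t - s) * r)) \<partial>lborel) \<le> ennreal (1 / \<nu>)"
proof (cases "s \<le> T")
  case True
  have "ennreal r * (\<integral>\<^sup>+t\<in>{s..T}. ennreal (exp (- \<nu> * (t - s) * r)) \<partial>lborel)
      = (\<integral>\<^sup>+t\<in>{s..T}. ennreal (r * exp (- \<nu> * (t - s) * r)) \<partial>lborel)"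
    using assms by (simp add: ennreal_mult mult.assoc nn_integral_cmult)
  also have "\<dots> = ennreal (- exp (- \<nu> * (T - s) * r) / \<nu> - - exp (- \<nu> * (s - s) * r) / \<nu>)"
    using True assms
    by (intro nn_integral_FTC_Icc[where F = "\<lambda>t. - exp (- \<nu> * (t - s) * r) / \<nu>"])
      (auto intro!: derivative_eq_intros)
  also have "\<dots> \<le> ennreal (1 / \<nu>)"
    using assms by (intro ennreal_leI) simp
  finally show ?thesis .
qed simp

definition heat_duhamel :: "real \<Rightarrow> (real \<Rightarrow> 'a::euclidean_space \<Rightarrow> ennreal) \<Rightarrow> real \<Rightarrow> 'a \<Rightarrow> ennreal" where
  "heat_duhamel \<nu> h t \<xi> = (\<integral>\<^sup>+s\<in>{0..t}. ennreal (exp (- \<nu> * (t - s) * (norm \<xi>)\<^sup>2)) * h s \<xi> \<partial>lborel)"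

lemma measurable_heat_duhamel [measurable (raw)]:
  assumes [measurable]: "jointly_measurable h" "t \<in> borel_measurable M" "f \<in> borel_measurable M"
  shows "(\<lambda>x. heat_duhamel \<nu> h (t x) (f x)) \<in> borel_measurable M"
  unfolding heat_duhamel_def by measurable

lemma heat_duhamel_mono:
  "(\<And>s. h s \<xi> \<le> h' s \<xi>) \<Longrightarrow> heat_duhamel \<nu> h t \<xi> \<le> heat_duhamel \<nu> h' t \<xi>"
  unfolding heat_duhamel_def by (intro nn_integral_mono mult_left_mono mult_right_mono) auto

lemma heat_duhamel_add:
  assumes [measurable]: "(\<lambda>s. f s \<xi>) \<in> borel_measurable borel" "(\<lambda>s. g s \<xi>) \<in> borel_measurable borel"
  shows "heat_duhamel \<nu> (\<lambda>s \<xi>. f s \<xi> + g s \<xi>) t \<xi> = heat_duhamel \<nu> f t \<xi> + heat_duhamel \<nu> g t \<xi>"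
  unfolding heat_duhamel_def by (simp add: distrib_left distrib_right nn_integral_add)

lemma heat_duhamel_le_nn_integral:
  assumes "\<nu> \<ge> 0" "t \<le> T"
  shows "heat_duhamel \<nu> h t \<xi> \<le> (\<integral>\<^sup>+s\<in>{0..T}. h s \<xi> \<partial>lborel)"
  unfolding heat_duhamel_def
proof (rule nn_integral_mono)
  fix s
  have "ennreal (exp (- \<nu> * (t - s) * (norm \<xi>)\<^sup>2)) * h s \<xi> \<le> 1 * h s \<xi>" if "s \<le> t"
    using that assms(1) by (intro mult_right_mono) auto
  then show "ennreal (exp (- \<nu> * (t - s) * (norm \<xi>)\<^sup>2)) * h s \<xi> * indicator {0..t} s
      \<le> h s \<xi> * indicator {0..T} s"
    using assms(2) by (auto split: split_indicator)
qed

lemma nn_integral_heat_duhamel_le: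
  assumes "\<nu> > 0" and [measurable]: "(\<lambda>s. h s \<xi>) \<in> borel_measurable borel"
  shows "ennreal ((norm \<xi>)\<^sup>2) * (\<integral>\<^sup>+t\<in>{0..T}. heat_duhamel \<nu> h t \<xi> \<partial>lborel)
    \<le> ennreal (1 / \<nu>) * (\<integral>\<^sup>+s\<in>{0..T}. h s \<xi> \<partial>lborel)"
proof -
  let ?E = "\<lambda>t s. ennreal (exp (- \<nu> * (t - s) * (norm \<xi>)\<^sup>2))"
  let ?H = "\<lambda>s. h s \<xi> * indicator {0..T} s"
  have "(\<integral>\<^sup>+t\<in>{0..T}. heat_duhamel \<nu> h t \<xi> \<partial>lborel)
      = (\<integral>\<^sup>+t. \<integral>\<^sup>+s. ?E t s * h s \<xi> * indicator {0..t} s * indicator {0..T} t \<partial>lborel \<partial>lborel)"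
    unfolding heat_duhamel_def by (simp add: nn_integral_multc)
  also have "\<dots> = (\<integral>\<^sup>+t. \<integral>\<^sup>+s. ?H s * (?E t s * indicator {s..T} t) \<partial>lborel \<partial>lborel)"
    by (intro nn_integral_cong) (auto simp: mult_ac split: split_indicator)
  also have "\<dots> = (\<integral>\<^sup>+s. \<integral>\<^sup>+t. ?H s * (?E t s * indicator {s..T} t) \<partial>lborel \<partial>lborel)"
    by (rule nn_integral_lborel_commute) measurable
  also have "\<dots> = (\<integral>\<^sup>+s. ?H s * (\<integral>\<^sup>+t\<in>{s..T}. ?E t s \<partial>lborel) \<partial>lborel)"
    by (simp add: nn_integral_cmult)
  finally have "ennreal ((norm \<xi>)\<^sup>2) * (\<integral>\<^sup>+t\<in>{0..T}. heat_duhamel \<nu> h t \<xi> \<partial>lborel)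
      = (\<integral>\<^sup>+s. ?H s * (ennreal ((norm \<xi>)\<^sup>2) * (\<integral>\<^sup>+t\<in>{s..T}. ?E t s \<partial>lborel)) \<partial>lborel)"
    by (simp add: mult.left_commute nn_integral_cmult)
  also have "\<dots> \<le> (\<integral>\<^sup>+s. ?H s * ennreal (1 / \<nu>) \<partial>lborel)"
    using assms(1) by (intro nn_integral_mono mult_left_mono nn_integral_exp_decay_le) auto
  also have "\<dots> = ennreal (1 / \<nu>) * (\<integral>\<^sup>+s\<in>{0..T}. h s \<xi> \<partial>lborel)"
    by (subst nn_integral_multc) (simp_all add: mult.commute)
  finally show ?thesis .
qed

lemma weighted_norm_heat_duhamel_le:
  assumes "\<nu> \<ge> 0" "t \<le> T" and [measurable]: "w \<in> borel_measurable borel" "jointly_measurable h"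
  shows "weighted_norm w (heat_duhamel \<nu> h t) \<le> (\<integral>\<^sup>+s\<in>{0..T}. weighted_norm w (h s) \<partial>lborel)"
proof -
  have "weighted_norm w (heat_duhamel \<nu> h t) \<le> weighted_norm w (\<lambda>\<xi>. \<integral>\<^sup>+s\<in>{0..T}. h s \<xi> \<partial>lborel)"
    by (intro weighted_norm_mono_AE AE_I2 heat_duhamel_le_nn_integral assms)
  also have "\<dots> = (\<integral>\<^sup>+s\<in>{0..T}. weighted_norm w (h s) \<partial>lborel)"
    by (rule weighted_norm_nn_integral) measurable
  finally show ?thesis .
qed

lemma nn_integral_weighted_norm_le_if_smoothing:
  fixes F :: "real \<Rightarrow> 'a::euclidean_space \<Rightarrow> ennreal"
  assumes [measurable]: "w \<in> borel_measurable borel" "jointly_measurable F" "G \<in> borel_measurable borel"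
    and w: "\<And>\<xi>. w \<xi> \<ge> 0"
    and smoothing: "\<And>\<xi>. ennreal ((norm \<xi>)\<^sup>2) * (\<integral>\<^sup>+t\<in>{0..T}. F t \<xi> \<partial>lborel) \<le> c * G \<xi>"
  shows "(\<integral>\<^sup>+t\<in>{0..T}. weighted_norm (\<lambda>\<xi>. (norm \<xi>)\<^sup>2 * w \<xi>) (F t) \<partial>lborel) \<le> c * weighted_norm w G"
proof -
  have "(\<integral>\<^sup>+t\<in>{0..T}. weighted_norm (\<lambda>\<xi>. (norm \<xi>)\<^sup>2 * w \<xi>) (F t) \<partial>lborel)
      = weighted_norm (\<lambda>\<xi>. (norm \<xi>)\<^sup>2 * w \<xi>) (\<lambda>\<xi>. \<integral>\<^sup>+t\<in>{0..T}. F t \<xi> \<partial>lborel)"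
    by (rule weighted_norm_nn_integral[symmetric]) measurable
  also have "\<dots> = weighted_norm w (\<lambda>\<xi>. ennreal ((norm \<xi>)\<^sup>2) * (\<integral>\<^sup>+t\<in>{0..T}. F t \<xi> \<partial>lborel))"
    by (rule weighted_norm_mult_ennreal[OF w, symmetric]) simp
  also have "\<dots> \<le> weighted_norm w (\<lambda>\<xi>. c * G \<xi>)"
    by (intro weighted_norm_mono_AE AE_I2 smoothing)
  also have "\<dots> = c * weighted_norm w G"
    by (rule weighted_norm_cmult) measurable
  finally show ?thesis .
qed

lemma nn_integral_weighted_norm_heat_duhamel_le:
  assumes "\<nu> > 0" and [measurable]: "w \<in> borel_measurable borel" "jointly_measurable h"
    and w: "\<And>\<xi>. w \<xi> \<ge> 0"
  shows "(\<integral>\<^sup>+t\<in>{0..T}. weighted_norm (\<lambda>\<xi>. (norm \<xi>)\<^sup>2 * w \<xi>) (heat_duhamel \<nu> h t) \<partial>lborel)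
    \<le> ennreal (1 / \<nu>) * (\<integral>\<^sup>+s\<in>{0..T}. weighted_norm w (h s) \<partial>lborel)"
proof -
  have "(\<integral>\<^sup>+t\<in>{0..T}. weighted_norm (\<lambda>\<xi>. (norm \<xi>)\<^sup>2 * w \<xi>) (heat_duhamel \<nu> h t) \<partial>lborel)
      \<le> ennreal (1 / \<nu>) * weighted_norm w (\<lambda>\<xi>. \<integral>\<^sup>+s\<in>{0..T}. h s \<xi> \<partial>lborel)"
    by (intro nn_integral_weighted_norm_le_if_smoothing nn_integral_heat_duhamel_le w assms(1))
        measurable
  also have "weighted_norm w (\<lambda>\<xi>. \<integral>\<^sup>+s\<in>{0..T}. h s \<xi> \<partial>lborel)
      = (\<integral>\<^sup>+s\<in>{0..T}. weighted_norm w (h s) \<partial>lborel)"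
    by (rule weighted_norm_nn_integral) measurable
  finally show ?thesis .
qed

lemma nn_integral_weighted_norm_heat_le:
  fixes f :: "'a::euclidean_space \<Rightarrow> ennreal"
  assumes "\<nu> > 0" and [measurable]: "w \<in> borel_measurable borel" "f \<in> borel_measurable borel"
    and w: "\<And>\<xi>. w \<xi> \<ge> 0"
  shows "(\<integral>\<^sup>+t\<in>{0..T}. weighted_norm (\<lambda>\<xi>. (norm \<xi>)\<^sup>2 * w \<xi>)
      (\<lambda>\<xi>. ennreal (exp (- \<nu> * t * (norm \<xi>)\<^sup>2)) * f \<xi>) \<partial>lborel) \<le> ennreal (1 / \<nu>) * weighted_norm w f"
proof (rule nn_integral_weighted_norm_le_if_smoothing)
  fix \<xi> :: 'a
  let ?E = "\<lambda>t. ennreal (exp (- \<nu> * t * (norm \<xi>)\<^sup>2))"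
  have "(\<integral>\<^sup>+t\<in>{0..T}. ?E t * f \<xi> \<partial>lborel) = (\<integral>\<^sup>+t. ?E t * indicator {0..T} t * f \<xi> \<partial>lborel)"
    by (simp add: mult_ac)
  also have "\<dots> = (\<integral>\<^sup>+t\<in>{0..T}. ?E t \<partial>lborel) * f \<xi>"
    by (rule nn_integral_multc) measurable
  finally have "ennreal ((norm \<xi>)\<^sup>2) * (\<integral>\<^sup>+t\<in>{0..T}. ?E t * f \<xi> \<partial>lborel)
      = (ennreal ((norm \<xi>)\<^sup>2) * (\<integral>\<^sup>+t\<in>{0..T}. ?E t \<partial>lborel)) * f \<xi>"
    by (simp only: mult.assoc)
  also have "\<dots> \<le> ennreal (1 / \<nu>) * f \<xi>"
    using nn_integral_exp_decay_le[OF assms(1), of "(norm \<xi>)\<^sup>2" 0 T] by (intro mult_right_mono) simp_all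
  finally show "ennreal ((norm \<xi>)\<^sup>2) * (\<integral>\<^sup>+t\<in>{0..T}. ?E t * f \<xi> \<partial>lborel) \<le> ennreal (1 / \<nu>) * f \<xi>" .
qed (use w in measurable)

lemma nn_integral_weighted_norm_heat_duhamel_power2_le:
  assumes "\<nu> > 0" and [measurable]: "w \<in> borel_measurable borel" "jointly_measurable h"
    and w: "\<And>\<xi>. w \<xi> \<ge> 0"
  shows "(\<integral>\<^sup>+t\<in>{0..T}. (weighted_norm (\<lambda>\<xi>. norm \<xi> * w \<xi>) (heat_duhamel \<nu> h t))\<^sup>2 \<partial>lborel)
    \<le> ennreal (1 / \<nu>) * (\<integral>\<^sup>+s\<in>{0..T}. weighted_norm w (h s) \<partial>lborel)\<^sup>2"
proof -
  let ?I = "\<integral>\<^sup>+s\<in>{0..T}. weighted_norm w (h s) \<partial>lborel"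
  have "(\<integral>\<^sup>+t\<in>{0..T}. (weighted_norm (\<lambda>\<xi>. norm \<xi> * w \<xi>) (heat_duhamel \<nu> h t))\<^sup>2 \<partial>lborel)
      \<le> ?I * (\<integral>\<^sup>+t\<in>{0..T}. weighted_norm (\<lambda>\<xi>. (norm \<xi>)\<^sup>2 * w \<xi>) (heat_duhamel \<nu> h t) \<partial>lborel)"
    using assms by (intro nn_integral_weighted_norm_interpolation weighted_norm_heat_duhamel_le) auto
  also have "\<dots> \<le> ?I * (ennreal (1 / \<nu>) * ?I)"
    by (intro mult_left_mono nn_integral_weighted_norm_heat_duhamel_le assms) simp
  finally show ?thesis by (simp add: power2_eq_square mult_ac)
qed

subsection \<open>The scalar bilinear Duhamel term\<close>

definition flux_majorant :: "('a::euclidean_space \<Rightarrow> ennreal) \<Rightarrow> ('a \<Rightarrow> ennreal) \<Rightarrow> 'a \<Rightarrow> ennreal" where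
  "flux_majorant f g \<xi> = ennreal (norm \<xi>) * convolution f g \<xi>"

definition bilinear_duhamel :: "real \<Rightarrow> (real \<Rightarrow> 'a::euclidean_space \<Rightarrow> ennreal) \<Rightarrow>
    (real \<Rightarrow> 'a \<Rightarrow> ennreal) \<Rightarrow> real \<Rightarrow> 'a \<Rightarrow> ennreal" where
  "bilinear_duhamel \<nu> m n = heat_duhamel \<nu> (\<lambda>s. flux_majorant (m s) (n s))"

lemma measurable_flux_majorant [measurable (raw)]:
  assumes [measurable]: "case_prod m \<in> borel_measurable (M \<Otimes>\<^sub>M borel)"
    "case_prod n \<in> borel_measurable (M \<Otimes>\<^sub>M borel)" "f \<in> borel_measurable M"
  shows "(\<lambda>x. flux_majorant (m x) (n x) (f x)) \<in> borel_measurable M"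
  unfolding flux_majorant_def by measurable

lemma
  assumes [measurable]: "f \<in> borel_measurable borel" "f' \<in> borel_measurable borel"
      "g \<in> borel_measurable borel"
  shows flux_majorant_add_left: "flux_majorant (\<lambda>\<eta>. f \<eta> + f' \<eta>) g
      = (\<lambda>\<xi>. flux_majorant f g \<xi> + flux_majorant f' g \<xi>)"
    and flux_majorant_add_right: "flux_majorant g (\<lambda>\<eta>. f \<eta> + f' \<eta>)
        = (\<lambda>\<xi>. flux_majorant g f \<xi> + flux_majorant g f' \<xi>)"
  by (simp_all add: fun_eq_iff flux_majorant_def convolution_add_left convolution_add_right distrib_left)

lemma measurable_bilinear_duhamel [measurable (raw)]:
  assumes [measurable]: "jointly_measurable m" "jointly_measurable n"
    "t \<in> borel_measurable M" "f \<in> borel_measurable M"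
  shows "(\<lambda>x. bilinear_duhamel \<nu> m n (t x) (f x)) \<in> borel_measurable M"
  unfolding bilinear_duhamel_def by measurable

lemma bilinear_duhamel_mono:
  assumes "\<And>s \<eta>. m s \<eta> \<le> m' s \<eta>" "\<And>s \<eta>. n s \<eta> \<le> n' s \<eta>"
  shows "bilinear_duhamel \<nu> m n t \<xi> \<le> bilinear_duhamel \<nu> m' n' t \<xi>"
  unfolding bilinear_duhamel_def flux_majorant_def
  by (intro heat_duhamel_mono mult_left_mono convolution_mono assms) simp

lemma
  assumes [measurable]: "jointly_measurable m" "jointly_measurable m'" "jointly_measurable n"
  shows bilinear_duhamel_add_left: "bilinear_duhamel \<nu> (\<lambda>s \<eta>. m s \<eta> + m' s \<eta>) n t \<xi>
      = bilinear_duhamel \<nu> m n t \<xi> + bilinear_duhamel \<nu> m' n t \<xi>"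
    and bilinear_duhamel_add_right: "bilinear_duhamel \<nu> n (\<lambda>s \<eta>. m s \<eta> + m' s \<eta>) t \<xi>
      = bilinear_duhamel \<nu> n m t \<xi> + bilinear_duhamel \<nu> n m' t \<xi>"
  unfolding bilinear_duhamel_def
  by (simp_all add: flux_majorant_add_left flux_majorant_add_right heat_duhamel_add)

definition scalar_flux_integrand :: "real \<Rightarrow> (real \<Rightarrow> 'a::euclidean_space \<Rightarrow> ennreal) \<Rightarrow>
    (real \<Rightarrow> 'a \<Rightarrow> ennreal) \<Rightarrow> real \<Rightarrow> 'a \<Rightarrow> real \<times> 'a \<Rightarrow> ennreal" where
  "scalar_flux_integrand \<nu> m n t \<xi> p = ennreal (exp (- \<nu> * (t - fst p) * (norm \<xi>)\<^sup>2) * norm \<xi>)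
     * (m (fst p) (\<xi> - snd p) * n (fst p) (snd p))"

lemma bilinear_duhamel_eq_nn_integral:
  assumes [measurable]: "jointly_measurable m" "jointly_measurable n"
  shows "bilinear_duhamel \<nu> m n t \<xi> = (\<integral>\<^sup>+p\<in>strip t. scalar_flux_integrand \<nu> m n t \<xi> p \<partial>lborel)"
proof -
  let ?k = "\<lambda>s \<eta>. ennreal (exp (- \<nu> * (t - s) * (norm \<xi>)\<^sup>2) * norm \<xi>)
      * (m s (\<xi> - \<eta>) * n s \<eta>) * indicator {0..t} s"
  have "(\<integral>\<^sup>+\<eta>. ?k s \<eta> \<partial>lborel) = ennreal (exp (- \<nu> * (t - s) * (norm \<xi>)\<^sup>2))
      * flux_majorant (m s) (n s) \<xi> * indicator {0..t} s" for s
    by (simp add: flux_majorant_def convolution_def nn_integral_cmult nn_integral_multc)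
      (simp add: ennreal_mult mult.assoc)
  then have "bilinear_duhamel \<nu> m n t \<xi> = (\<integral>\<^sup>+s. \<integral>\<^sup>+\<eta>. ?k s \<eta> \<partial>lborel \<partial>lborel)"
    unfolding bilinear_duhamel_def heat_duhamel_def by simp
  also have "\<dots> = (\<integral>\<^sup>+p. ?k (fst p) (snd p) \<partial>lborel)"
    by (rule nn_integral_lborel_prod_eq_iterated[symmetric]) measurable
  finally show ?thesis
    by (simp add: scalar_flux_integrand_def indicator_def mem_Times_iff)
qed

subsection \<open>The Leray-projected flux\<close>

definition cdot :: "real^'n \<Rightarrow> complex^'n \<Rightarrow> complex" where
  "cdot \<xi> w = (\<Sum>j\<in>UNIV. complex_of_real (\<xi> $ j) * w $ j)"

lemma norm_cdot_le: "norm (cdot \<xi> w) \<le> norm \<xi> * norm w"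
proof -
  have "norm (cdot \<xi> w) \<le> (\<Sum>j\<in>UNIV. norm (complex_of_real (\<xi> $ j) * w $ j))"
    unfolding cdot_def by (rule norm_sum)
  also have "\<dots> = (\<Sum>j\<in>UNIV. \<bar>\<xi> $ j\<bar> * \<bar>norm (w $ j)\<bar>)"
    by (simp add: norm_mult)
  also have "\<dots> \<le> L2_set (($) \<xi>) UNIV * L2_set (\<lambda>j. norm (w $ j)) UNIV"
    by (rule L2_set_mult_ineq)
  also have "L2_set (($) \<xi>) UNIV = norm \<xi>"
    by (simp add: norm_vec_def L2_set_def)
  finally show ?thesis by (simp add: norm_vec_def)
qed

lemma bounded_linear_cdot:
  fixes \<xi> :: "real^'n"
  shows "bounded_linear (cdot \<xi>)"
proof
  fix x y :: "complex^'n" and r :: real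
  show "cdot \<xi> (x + y) = cdot \<xi> x + cdot \<xi> y"
    by (simp add: cdot_def ring_distribs sum.distrib)
  show "cdot \<xi> (r *\<^sub>R x) = r *\<^sub>R cdot \<xi> x"
    by (simp add: cdot_def scaleR_sum_right mult_ac)
  show "\<exists>K. \<forall>x. norm (cdot \<xi> x) \<le> norm x * K"
    using norm_cdot_le[of \<xi>] by (intro exI[of _ "norm \<xi>"]) (simp add: mult_ac)
qed

lemmas cdot_add = linear_add[OF bounded_linear.linear[OF bounded_linear_cdot]]
  and cdot_diff = linear_diff[OF bounded_linear.linear[OF bounded_linear_cdot]]
  and cdot_scaleR = linear_scale[OF bounded_linear.linear[OF bounded_linear_cdot]]

lemma cdot_set_lebesgue_integral_eq_0:
  assumes "\<And>x. cdot \<xi> (f x) = 0"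
  shows "cdot \<xi> (LINT x:A|M. f x) = 0"
proof (cases "integrable M (\<lambda>x. indicat_real A x *\<^sub>R f x)")
  case True
  from integral_bounded_linear[OF bounded_linear_cdot this, of \<xi>] show ?thesis
    by (simp add: set_lebesgue_integral_def cdot_scaleR assms)
next
  case False
  then show ?thesis by (simp add: set_lebesgue_integral_def not_integrable_integral_eq cdot_def)
qed

lemma inner_smult_eq_Re_cdot:
  "inner w (\<chi> k. c * complex_of_real (\<xi> $ k)) = Re (cnj c * cdot \<xi> w)"
  by (simp add: inner_vec_def cdot_def inner_complex_def sum_distrib_left algebra_simps sum.distrib)

lemma leray_eq_diff: "leray \<xi> w
    = w - (\<chi> k. (cdot \<xi> w / complex_of_real ((norm \<xi>)\<^sup>2)) * complex_of_real (\<xi> $ k))"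
  by (simp add: leray_def cdot_def vec_eq_iff)

lemma cdot_leray: "cdot \<xi> (leray \<xi> w) = 0"
proof (cases "\<xi> = 0")
  case True
  then show ?thesis by (simp add: cdot_def)
next
  case False
  define c where "c = cdot \<xi> w / complex_of_real ((norm \<xi>)\<^sup>2)"
  have "cdot \<xi> (leray \<xi> w) = cdot \<xi> w - c * (\<Sum>j\<in>UNIV. complex_of_real (\<xi> $ j * \<xi> $ j))"
    unfolding leray_eq_diff cdot_diff c_def[symmetric] by (simp add: cdot_def sum_distrib_left mult_ac)
  also have "(\<Sum>j\<in>UNIV. complex_of_real (\<xi> $ j * \<xi> $ j)) = complex_of_real ((norm \<xi>)\<^sup>2)"
    by (simp add: power2_norm_eq_inner inner_vec_def del: of_real_mult flip: of_real_sum)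
  finally show ?thesis using False by (simp add: c_def)
qed

lemma norm_leray_le: "norm (leray \<xi> w) \<le> norm w"
proof -
  define c where "c = cdot \<xi> w / complex_of_real ((norm \<xi>)\<^sup>2)"
  define e :: "complex^3" where "e = (\<chi> k. c * complex_of_real (\<xi> $ k))"
  have "inner (leray \<xi> w) e = 0"
    by (simp only: e_def inner_smult_eq_Re_cdot cdot_leray) simp
  then have "(norm (leray \<xi> w + e))\<^sup>2 = (norm (leray \<xi> w))\<^sup>2 + (norm e)\<^sup>2"
    by (intro norm_add_Pythagorean) (simp add: orthogonal_def)
  moreover have "leray \<xi> w + e = w"
    unfolding leray_eq_diff e_def c_def by simp
  ultimately have "(norm (leray \<xi> w))\<^sup>2 \<le> (norm w)\<^sup>2" by simp
  then show ?thesis by (rule power2_le_imp_le) simp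
qed

lemma linear_leray: "linear (leray \<xi>)"
  by (rule linearI)
    (simp_all add: leray_eq_diff cdot_add cdot_scaleR vec_eq_iff ring_distribs
        add_divide_distrib scaleR_conv_of_real[where 'a = complex] mult_ac)

text \<open>The symbol of \<open>x \<otimes> y \<mapsto> P div (x \<otimes> y)\<close>. Unlike the convective form of the nonlinearity it is
  bounded by \<open>|\<xi>|\<close> without any divergence condition, which cancels the singular weight of \<open>Z\<^sup>-\<^sup>1\<close>.\<close>

definition leray_flux :: "real^3 \<Rightarrow> complex^3 \<Rightarrow> complex^3 \<Rightarrow> complex^3" where
  "leray_flux \<xi> x y = leray \<xi> (\<chi> k. \<i> * cdot \<xi> x * y $ k)"

lemma norm_leray_flux_le: "norm (leray_flux \<xi> x y) \<le> norm \<xi> * (norm x * norm y)"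
proof -
  have "norm (leray_flux \<xi> x y) \<le> norm (\<chi> k. \<i> * cdot \<xi> x * y $ k)"
    unfolding leray_flux_def by (rule norm_leray_le)
  also have "\<dots> = norm (cdot \<xi> x) * norm y"
    by (simp add: norm_vec_def norm_mult L2_set_right_distrib)
  also have "\<dots> \<le> norm \<xi> * norm x * norm y"
    by (intro mult_right_mono norm_cdot_le) simp
  finally show ?thesis by simp
qed

lemma bounded_bilinear_leray_flux: "bounded_bilinear (leray_flux \<xi>)"
proof
  fix x x' y y' :: "complex^3" and r :: real
  show "leray_flux \<xi> (x + x') y = leray_flux \<xi> x y + leray_flux \<xi> x' y"
    and "leray_flux \<xi> x (y + y') = leray_flux \<xi> x y + leray_flux \<xi> x y'"
    unfolding leray_flux_def linear_add[OF linear_leray, symmetric]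
    by (intro arg_cong[where f = "leray \<xi>"]; simp add: vec_eq_iff cdot_add ring_distribs)+
  show "leray_flux \<xi> (r *\<^sub>R x) y = r *\<^sub>R leray_flux \<xi> x y"
    and "leray_flux \<xi> x (r *\<^sub>R y) = r *\<^sub>R leray_flux \<xi> x y"
    unfolding leray_flux_def linear_scale[OF linear_leray, symmetric]
    by (intro arg_cong[where f = "leray \<xi>"]; simp add: vec_eq_iff cdot_scaleR)+
  show "\<exists>K. \<forall>x y. norm (leray_flux \<xi> x y) \<le> norm x * norm y * K"
    using norm_leray_flux_le[of \<xi>] by (intro exI[of _ "norm \<xi>"]) (simp add: mult_ac)
qed

interpretation leray_flux: bounded_bilinear "leray_flux \<xi>" for \<xi>
  by (rule bounded_bilinear_leray_flux)

lemma leray_nonlin_integrand_eq_leray_flux: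
  assumes "cdot (\<xi> - \<eta>) (w (\<xi> - \<eta>)) = 0"
  shows "leray \<xi> (nonlin_integrand w \<xi> \<eta>) = leray_flux \<xi> (w (\<xi> - \<eta>)) (w \<eta>)"
proof -
  have "cdot \<xi> (w (\<xi> - \<eta>)) = cdot \<eta> (w (\<xi> - \<eta>))"
    using assms by (simp add: cdot_def algebra_simps sum_subtractf)
  then show ?thesis
    unfolding leray_flux_def nonlin_integrand_def
    by (simp add: cdot_def sum_distrib_left sum_distrib_right mult_ac)
qed

lemma measurable_cdot [measurable (raw)]:
  assumes [measurable]: "f \<in> borel_measurable M" "x \<in> borel_measurable M"
  shows "(\<lambda>z. cdot (f z) (x z)) \<in> borel_measurable M"
  unfolding cdot_def by measurable

lemma measurable_leray [measurable (raw)]: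
  assumes [measurable]: "f \<in> borel_measurable M" "x \<in> borel_measurable M"
  shows "(\<lambda>z. leray (f z) (x z)) \<in> borel_measurable M"
  by (rule borel_measurable_vecI) (simp add: leray_def del: of_real_power)

lemma measurable_leray_flux [measurable (raw)]:
  assumes [measurable]: "f \<in> borel_measurable M" "x \<in> borel_measurable M" "y \<in> borel_measurable M"
  shows "(\<lambda>z. leray_flux (f z) (x z) (y z)) \<in> borel_measurable M"
proof -
  have [measurable]: "(\<lambda>z. \<chi> k. \<i> * cdot (f z) (x z) * y z $ k) \<in> borel_measurable M"
    by (rule borel_measurable_vecI) simp
  show ?thesis unfolding leray_flux_def by measurable
qed

lemma measurable_nonlin_integrand [measurable (raw)]:
  assumes [measurable]: "jointly_measurable w"
    "t \<in> borel_measurable M" "f \<in> borel_measurable M" "g \<in> borel_measurable M"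
  shows "(\<lambda>z. nonlin_integrand (w (t z)) (f z) (g z)) \<in> borel_measurable M"
  by (rule borel_measurable_vecI) (simp add: nonlin_integrand_def)

subsection \<open>The vector-valued Duhamel integral\<close>

abbreviation enorm :: "('a \<Rightarrow> 'b \<Rightarrow> 'c::real_normed_vector) \<Rightarrow> 'a \<Rightarrow> 'b \<Rightarrow> ennreal" where
  "enorm v \<equiv> \<lambda>s \<eta>. ennreal (norm (v s \<eta>))"

lemma measurable_enorm:
  fixes v :: "'a::topological_space \<Rightarrow> 'b::topological_space \<Rightarrow> 'c::real_normed_vector"
  assumes [measurable]: "jointly_measurable v"
  shows "jointly_measurable (enorm v)"
  by measurable

definition flux_integrand :: "real \<Rightarrow> (real \<Rightarrow> real^3 \<Rightarrow> complex^3) \<Rightarrow> (real \<Rightarrow> real^3 \<Rightarrow> complex^3) \<Rightarrow>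
    real \<Rightarrow> real^3 \<Rightarrow> real \<times> (real^3) \<Rightarrow> complex^3" where
  "flux_integrand \<nu> x y t \<xi> p = (exp (- \<nu> * (t - fst p) * (norm \<xi>)\<^sup>2) / (2 * pi) ^ 3)
     *\<^sub>R leray_flux \<xi> (x (fst p) (\<xi> - snd p)) (y (fst p) (snd p))"

lemma measurable_flux_integrand [measurable (raw)]:
  assumes [measurable]: "jointly_measurable x" "jointly_measurable y"
    "t \<in> borel_measurable M" "f \<in> borel_measurable M" "p \<in> measurable M (borel \<Otimes>\<^sub>M borel)"
  shows "(\<lambda>z. flux_integrand \<nu> x y (t z) (f z) (p z)) \<in> borel_measurable M"
  unfolding flux_integrand_def by measurable

lemma set_borel_measurable_flux_integrand:
  assumes [measurable]: "jointly_measurable x" "jointly_measurable y"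
  shows "set_borel_measurable lborel (strip t) (flux_integrand \<nu> x y t \<xi>)"
  by (rule set_borel_measurable_strip) (unfold flux_integrand_def[abs_def], measurable)

lemma set_borel_measurable_duhamel_integrand:
  assumes [measurable]: "jointly_measurable v"
  shows "set_borel_measurable lborel (strip t) (duhamel_integrand \<nu> v t \<xi>)"
  by (rule set_borel_measurable_strip) (unfold duhamel_integrand_def[abs_def], measurable)

lemma AE_duhamel_integrand_eq_flux_integrand:
  assumes "AE \<xi> in lborel. \<forall>s\<in>{0..t}. cdot \<xi> (v s \<xi>) = 0"
  shows "AE p in lborel. p \<in> strip t \<longrightarrow> duhamel_integrand \<nu> v t \<xi> p = flux_integrand \<nu> v v t \<xi> p"
  using AE_lborel_snd[OF AE_lborel_diff[OF assms, of \<xi>], where 'a = real]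
  by eventually_elim
    (auto simp: duhamel_integrand_def flux_integrand_def leray_nonlin_integrand_eq_leray_flux)

lemma AE_duhamel_integrand_cong:
  assumes w: "set_borel_measurable lborel (strip t) (duhamel_integrand \<nu> w t \<xi>)"
    and v: "jointly_measurable v"
    and eq: "\<And>s. s \<in> {0..t} \<Longrightarrow> AE \<eta> in lborel. w s \<eta> = v s \<eta>"
  shows "AE p in lborel. p \<in> strip t \<longrightarrow> duhamel_integrand \<nu> w t \<xi> p = duhamel_integrand \<nu> v t \<xi> p"
proof -
  let ?I = "\<lambda>u p. indicat_real (strip t) p *\<^sub>R duhamel_integrand \<nu> u t \<xi> p"
  have "AE p in lborel. ?I w p = ?I v p"
  proof (rule AE_lborel_pairI)
    have [measurable]: "?I w \<in> borel_measurable (borel \<Otimes>\<^sub>M borel)"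
      "?I v \<in> borel_measurable (borel \<Otimes>\<^sub>M borel)"
      using w set_borel_measurable_duhamel_integrand[OF v]
      by (simp_all add: set_borel_measurable_def borel_prod)
    show "Measurable.pred (borel \<Otimes>\<^sub>M borel) (\<lambda>p. ?I w p = ?I v p)" by measurable
    show "AE s in lborel. AE \<eta> in lborel. ?I w (s, \<eta>) = ?I v (s, \<eta>)"
    proof (rule AE_I2)
      fix s
      show "AE \<eta> in lborel. ?I w (s, \<eta>) = ?I v (s, \<eta>)"
      proof (cases "s \<in> {0..t}")
        case True
        from eq[OF True] AE_lborel_diff[OF eq[OF True], of \<xi>] show ?thesis
          by eventually_elim (simp add: duhamel_integrand_def nonlin_integrand_def)
      qed (simp add: indicator_def)
    qed
  qed
  then show ?thesis by eventually_elim (auto simp: indicator_def)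
qed

lemma flux_integrand_diff:
  "flux_integrand \<nu> v v t \<xi> p - flux_integrand \<nu> w w t \<xi> p
    = flux_integrand \<nu> (\<lambda>s \<eta>. v s \<eta> - w s \<eta>) v t \<xi> p + flux_integrand \<nu> w (\<lambda>s \<eta>. v s \<eta> - w s \<eta>) t \<xi> p"
  by (simp add: flux_integrand_def leray_flux.diff_left leray_flux.diff_right algebra_simps)

lemma ennreal_norm_flux_integrand_le:
  "ennreal (norm (flux_integrand \<nu> x y t \<xi> p)) \<le> scalar_flux_integrand \<nu> (enorm x) (enorm y) t \<xi> p"
proof -
  let ?E = "exp (- \<nu> * (t - fst p) * (norm \<xi>)\<^sup>2)"
  have "1 \<le> (2 * pi) ^ 3" using pi_gt3 by (intro one_le_power) simp
  then have "?E / (2 * pi) ^ 3 \<le> ?E" by (simp add: divide_le_eq)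
  then have "norm (flux_integrand \<nu> x y t \<xi> p)
      \<le> ?E * (norm \<xi> * (norm (x (fst p) (\<xi> - snd p)) * norm (y (fst p) (snd p))))"
    unfolding flux_integrand_def norm_scaleR by (intro mult_mono norm_leray_flux_le) simp_all
  from ennreal_leI[OF this] show ?thesis
    by (simp add: scalar_flux_integrand_def ennreal_mult mult.assoc)
qed

lemma nn_integral_norm_flux_integrand_le:
  assumes [measurable]: "jointly_measurable x" "jointly_measurable y"
  shows "(\<integral>\<^sup>+p. ennreal (norm (indicat_real (strip t) p *\<^sub>R flux_integrand \<nu> x y t \<xi> p)) \<partial>lborel)
    \<le> bilinear_duhamel \<nu> (enorm x) (enorm y) t \<xi>"
  unfolding bilinear_duhamel_eq_nn_integral[OF measurable_enorm[OF assms(1)] measurable_enorm[OF assms(2)]]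
  by (intro nn_integral_mono) (simp add: indicator_def ennreal_norm_flux_integrand_le)

lemma set_integrable_flux_integrand:
  assumes [measurable]: "jointly_measurable x" "jointly_measurable y"
    and finite: "bilinear_duhamel \<nu> (enorm x) (enorm y) t \<xi> < \<infinity>"
  shows "set_integrable lborel (strip t) (flux_integrand \<nu> x y t \<xi>)"
  unfolding set_integrable_def
proof (rule integrableI_bounded)
  show "(\<lambda>p. indicat_real (strip t) p *\<^sub>R flux_integrand \<nu> x y t \<xi> p) \<in> borel_measurable lborel"
    using set_borel_measurable_flux_integrand[OF assms(1,2)] by (simp only: set_borel_measurable_def)
  show "(\<integral>\<^sup>+p. ennreal (norm (indicat_real (strip t) p *\<^sub>R flux_integrand \<nu> x y t \<xi> p)) \<partial>lborel) < \<infinity>"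
    using nn_integral_norm_flux_integrand_le[OF assms(1,2)] finite by (rule order.strict_trans1)
qed

definition duhamel_flux :: "real \<Rightarrow> (real \<Rightarrow> real^3 \<Rightarrow> complex^3) \<Rightarrow> real \<Rightarrow> real^3 \<Rightarrow> complex^3" where
  "duhamel_flux \<nu> v t \<xi> = (LINT p : strip t | lborel. flux_integrand \<nu> v v t \<xi> p)"

lemma cdot_duhamel_flux: "cdot \<xi> (duhamel_flux \<nu> v t \<xi>) = 0"
  unfolding duhamel_flux_def
  by (rule cdot_set_lebesgue_integral_eq_0)
    (simp add: flux_integrand_def leray_flux_def cdot_scaleR cdot_leray)

lemma measurable_duhamel_flux [measurable]:
  assumes [measurable]: "jointly_measurable v"
  shows "jointly_measurable (duhamel_flux \<nu> v)"
proof -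
  let ?f = "\<lambda>(z :: real \<times> (real^3)) p. indicat_real {0..fst z} (fst p)
      *\<^sub>R flux_integrand \<nu> v v (fst z) (snd z) p"
  have sets: "sets ((borel \<Otimes>\<^sub>M borel) \<Otimes>\<^sub>M lborel) = sets ((borel \<Otimes>\<^sub>M borel) \<Otimes>\<^sub>M (borel \<Otimes>\<^sub>M borel)
      :: ((real \<times> (real^3)) \<times> (real \<times> (real^3))) measure)"
    by (rule sets_pair_measure_cong) (simp_all only: sets_lborel borel_prod)
  have "case_prod ?f \<in> borel_measurable ((borel \<Otimes>\<^sub>M borel) \<Otimes>\<^sub>M (borel \<Otimes>\<^sub>M borel))" by measurable
  then have "case_prod ?f \<in> borel_measurable ((borel \<Otimes>\<^sub>M borel) \<Otimes>\<^sub>M lborel)"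
    by (subst measurable_cong_sets[OF sets refl])
  from lborel.borel_measurable_lebesgue_integral[OF this]
  have "(\<lambda>z. \<integral>p. ?f z p \<partial>lborel) \<in> borel_measurable (borel \<Otimes>\<^sub>M borel)" .
  moreover have "case_prod (duhamel_flux \<nu> v) = (\<lambda>z. \<integral>p. ?f z p \<partial>lborel)"
    unfolding duhamel_flux_def set_lebesgue_integral_def
    by (auto simp: fun_eq_iff indicator_def mem_Times_iff intro!: Bochner_Integration.integral_cong)
  ultimately show ?thesis by simp
qed

lemma norm_duhamel_flux_le:
  assumes [measurable]: "jointly_measurable v"
  shows "enorm (duhamel_flux \<nu> v) t \<xi> \<le> bilinear_duhamel \<nu> (enorm v) (enorm v) t \<xi>"
proof (cases "bilinear_duhamel \<nu> (enorm v) (enorm v) t \<xi> < \<infinity>")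
  case True
  have "set_integrable lborel (strip t) (flux_integrand \<nu> v v t \<xi>)"
    by (rule set_integrable_flux_integrand[OF assms assms True])
  then have "enorm (duhamel_flux \<nu> v) t \<xi>
      \<le> (\<integral>\<^sup>+p. ennreal (norm (indicat_real (strip t) p *\<^sub>R flux_integrand \<nu> v v t \<xi> p)) \<partial>lborel)"
    unfolding duhamel_flux_def set_lebesgue_integral_def set_integrable_def
    by (rule integral_norm_bound_ennreal)
  also have "\<dots> \<le> bilinear_duhamel \<nu> (enorm v) (enorm v) t \<xi>"
    by (rule nn_integral_norm_flux_integrand_le) measurable
  finally show ?thesis .
next
  case False
  then show ?thesis by (simp add: less_top[symmetric])
qed

lemma norm_duhamel_flux_diff_le:
  assumes [measurable]: "jointly_measurable v" "jointly_measurable w"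
    and v: "set_integrable lborel (strip t) (flux_integrand \<nu> v v t \<xi>)"
    and w: "set_integrable lborel (strip t) (flux_integrand \<nu> w w t \<xi>)"
  defines "d \<equiv> \<lambda>s \<eta>. v s \<eta> - w s \<eta>"
  shows "ennreal (norm (duhamel_flux \<nu> v t \<xi> - duhamel_flux \<nu> w t \<xi>))
    \<le> bilinear_duhamel \<nu> (enorm d) (enorm v) t \<xi> + bilinear_duhamel \<nu> (enorm w) (enorm d) t \<xi>"
proof -
  have [measurable]: "jointly_measurable d" unfolding d_def by measurable
  let ?F = "\<lambda>x y p. ennreal (norm (indicat_real (strip t) p *\<^sub>R flux_integrand \<nu> x y t \<xi> p))"
  have F_measurable: "?F x y \<in> borel_measurable lborel"
      if "jointly_measurable x" "jointly_measurable y" for x y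
    using set_borel_measurable_flux_integrand[OF that] unfolding set_borel_measurable_def by measurable
  have "duhamel_flux \<nu> v t \<xi> - duhamel_flux \<nu> w t \<xi>
      = (LINT p : strip t | lborel. flux_integrand \<nu> v v t \<xi> p - flux_integrand \<nu> w w t \<xi> p)"
    unfolding duhamel_flux_def by (rule set_integral_diff(2)[OF v w, symmetric])
  also have "ennreal (norm \<dots>)
      \<le> (\<integral>\<^sup>+p. ennreal (norm (indicat_real (strip t) p *\<^sub>R
          (flux_integrand \<nu> v v t \<xi> p - flux_integrand \<nu> w w t \<xi> p))) \<partial>lborel)"
    using set_integral_diff(1)[OF v w] unfolding set_lebesgue_integral_def set_integrable_def
    by (rule integral_norm_bound_ennreal)
  also have "\<dots> \<le> (\<integral>\<^sup>+p. ?F d v p + ?F w d p \<partial>lborel)"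
    unfolding flux_integrand_diff d_def
    by (intro nn_integral_mono) (auto simp: indicator_def norm_triangle_ineq simp flip: ennreal_plus)
  also have "\<dots> = (\<integral>\<^sup>+p. ?F d v p \<partial>lborel) + (\<integral>\<^sup>+p. ?F w d p \<partial>lborel)"
    by (intro nn_integral_add F_measurable) measurable
  also have "\<dots> \<le> bilinear_duhamel \<nu> (enorm d) (enorm v) t \<xi> + bilinear_duhamel \<nu> (enorm w) (enorm d) t \<xi>"
    by (intro add_mono nn_integral_norm_flux_integrand_le) measurable
  finally show ?thesis .
qed

lemma duhamel_flux_diff_majorant:
  assumes [measurable]: "jointly_measurable v" "jointly_measurable w"
      "jointly_measurable m" "jointly_measurable n"
    and v: "\<And>s \<eta>. enorm v s \<eta> \<le> n s \<eta>" and w: "\<And>s \<eta>. enorm w s \<eta> \<le> m s \<eta>"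
    and diff: "\<And>s \<eta>. ennreal (norm (v s \<eta> - w s \<eta>)) + m s \<eta> \<le> n s \<eta>"
  shows "ennreal (norm (duhamel_flux \<nu> v t \<xi> - duhamel_flux \<nu> w t \<xi>)) + bilinear_duhamel \<nu> m m t \<xi>
    \<le> bilinear_duhamel \<nu> n n t \<xi>"
proof (cases "bilinear_duhamel \<nu> n n t \<xi> < \<infinity>")
  case False
  then show ?thesis by (simp add: less_top[symmetric])
next
  case True
  define d where "d = (\<lambda>s \<eta>. v s \<eta> - w s \<eta>)"
  have [measurable]: "jointly_measurable d" unfolding d_def by measurable
  have m_le: "m s \<eta> \<le> n s \<eta>" for s \<eta>
    using diff[of s \<eta>] by (meson add_increasing order_refl order_trans zero_le)
  have integrable: "set_integrable lborel (strip t) (flux_integrand \<nu> x x t \<xi>)"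
    if [measurable]: "jointly_measurable x" and "\<And>s \<eta>. enorm x s \<eta> \<le> n s \<eta>" for x
    by (rule set_integrable_flux_integrand[OF that(1) that(1)
          order.strict_trans1[OF bilinear_duhamel_mono[OF that(2) that(2)] True]])
  let ?B = "\<lambda>x y. bilinear_duhamel \<nu> x y t \<xi>"
  have "ennreal (norm (duhamel_flux \<nu> v t \<xi> - duhamel_flux \<nu> w t \<xi>))
      \<le> ?B (enorm d) (enorm v) + ?B (enorm w) (enorm d)"
    unfolding d_def using v order_trans[OF w m_le]
    by (intro norm_duhamel_flux_diff_le integrable) measurable
  also have "\<dots> \<le> ?B (enorm d) n + ?B m (enorm d)"
    by (intro add_mono bilinear_duhamel_mono v w order_refl)
  finally have "ennreal (norm (duhamel_flux \<nu> v t \<xi> - duhamel_flux \<nu> w t \<xi>)) + ?B m m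
      \<le> ?B (enorm d) n + (?B m (enorm d) + ?B m m)"
    by (simp add: add_right_mono add.assoc[symmetric])
  also have "?B m (enorm d) + ?B m m = ?B m (\<lambda>s \<eta>. enorm d s \<eta> + m s \<eta>)"
    by (rule bilinear_duhamel_add_right[symmetric]) measurable
  also have "\<dots> \<le> ?B m n"
    unfolding d_def by (intro bilinear_duhamel_mono diff order_refl)
  also have "?B (enorm d) n + ?B m n = ?B (\<lambda>s \<eta>. enorm d s \<eta> + m s \<eta>) n"
    by (rule bilinear_duhamel_add_left[symmetric]) measurable
  also have "\<dots> \<le> ?B n n"
    unfolding d_def by (intro bilinear_duhamel_mono diff order_refl)
  finally show ?thesis by (simp add: add_left_mono)
qed

lemma duhamel_flux_tendsto:
  assumes [measurable]: "\<And>n. jointly_measurable (X n)" "jointly_measurable x" "jointly_measurable m"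
    and bound: "\<And>n s \<eta>. enorm (X n) s \<eta> \<le> m s \<eta>"
    and finite: "bilinear_duhamel \<nu> m m t \<xi> < \<infinity>"
    and lim: "AE \<eta> in lborel. \<forall>s\<in>{0..t}. (\<lambda>n. X n s \<eta>) \<longlonglongrightarrow> x s \<eta>"
  shows "(\<lambda>n. duhamel_flux \<nu> (X n) t \<xi>) \<longlonglongrightarrow> duhamel_flux \<nu> x t \<xi>"
  unfolding duhamel_flux_def set_lebesgue_integral_def
proof (rule integral_dominated_convergence_ennreal)
  let ?K = "scalar_flux_integrand \<nu> m m t \<xi>"
  show "(\<lambda>p. indicat_real (strip t) p *\<^sub>R flux_integrand \<nu> (X n) (X n) t \<xi> p) \<in> borel_measurable lborel"
      for n
    using set_borel_measurable_flux_integrand[OF assms(1,1)] by (simp only: set_borel_measurable_def)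
  show "(\<lambda>p. indicat_real (strip t) p *\<^sub>R flux_integrand \<nu> x x t \<xi> p) \<in> borel_measurable lborel"
    using set_borel_measurable_flux_integrand[OF assms(2,2)] by (simp only: set_borel_measurable_def)
  have "?K \<in> borel_measurable lborel"
    by (rule borel_measurable_lborel_prodI) (unfold scalar_flux_integrand_def[abs_def], measurable)
  then show "(\<lambda>p. ?K p * indicator (strip t) p) \<in> borel_measurable lborel"
    by (rule borel_measurable_times_ennreal) (rule borel_measurable_indicator, simp)
  show "(\<integral>\<^sup>+p\<in>strip t. ?K p \<partial>lborel) < \<infinity>"
    using finite by (simp only: bilinear_duhamel_eq_nn_integral[OF assms(3,3)])
  have "ennreal (norm (flux_integrand \<nu> (X n) (X n) t \<xi> p)) \<le> ?K p" for n p
    by (rule order_trans[OF ennreal_norm_flux_integrand_le])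
      (unfold scalar_flux_integrand_def, intro mult_left_mono mult_mono bound, simp_all)
  then show "AE p in lborel. ennreal (norm (indicat_real (strip t) p *\<^sub>R
        flux_integrand \<nu> (X n) (X n) t \<xi> p)) \<le> ?K p * indicator (strip t) p" for n
    by (simp add: indicator_def)
  have "AE \<eta> in lborel. \<forall>s\<in>{0..t}. (\<lambda>n. X n s (\<xi> - \<eta>)) \<longlonglongrightarrow> x s (\<xi> - \<eta>) \<and> (\<lambda>n. X n s \<eta>) \<longlonglongrightarrow> x s \<eta>"
    using AE_lborel_diff[OF lim, of \<xi>] lim by eventually_elim simp
  from AE_lborel_snd[OF this, where 'a = real]
  show "AE p in lborel. (\<lambda>n. indicat_real (strip t) p *\<^sub>R flux_integrand \<nu> (X n) (X n) t \<xi> p)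
      \<longlonglongrightarrow> indicat_real (strip t) p *\<^sub>R flux_integrand \<nu> x x t \<xi> p"
  proof eventually_elim
    case (elim p)
    then show ?case
      by (cases "p \<in> strip t")
        (auto simp: flux_integrand_def intro!: tendsto_scaleR leray_flux.tendsto)
  qed
qed

lemma duhamel_kernel_rescale:
  fixes N :: "'b::real_vector"
  shows "(exp (- \<nu> * (t - s) * r) / c) *\<^sub>R N
      = exp (\<nu> * (T - t) * r) *\<^sub>R ((exp (- \<nu> * (T - s) * r) / c) *\<^sub>R N)"
proof -
  have "exp (- \<nu> * (t - s) * r) = exp (\<nu> * (T - t) * r) * exp (- \<nu> * (T - s) * r)"
    by (simp add: algebra_simps flip: exp_add)
  then show ?thesis by simp
qed

lemma set_integrable_duhamel:
  fixes N :: "real \<times> 'b::euclidean_space \<Rightarrow> 'c::{banach, second_countable_topology}"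
  assumes "set_integrable lborel (strip T) (\<lambda>p. (exp (- \<nu> * (T - fst p) * r) / c) *\<^sub>R N p)" and "t \<le> T"
  shows "set_integrable lborel (strip t) (\<lambda>p. (exp (- \<nu> * (t - fst p) * r) / c) *\<^sub>R N p)"
proof -
  have "set_integrable lborel (strip t) (\<lambda>p. (exp (- \<nu> * (T - fst p) * r) / c) *\<^sub>R N p)"
    using assms(1) by (rule set_integrable_subset) (use assms(2) in auto)
  then show ?thesis
    unfolding duhamel_kernel_rescale[where t = t and T = T] by (rule set_integrable_scaleR_right)
qed

lemma continuous_on_duhamel:
  fixes N :: "real \<times> 'b::euclidean_space \<Rightarrow> 'c::{banach, second_countable_topology}"
  assumes integrable: "set_integrable lborel (strip T) (\<lambda>p. (exp (- \<nu> * (T - fst p) * r) / c) *\<^sub>R N p)"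
  shows "continuous_on {0..T} (\<lambda>t. LINT p : strip t | lborel. (exp (- \<nu> * (t - fst p) * r) / c) *\<^sub>R N p)"
proof -
  have "continuous_on {0..T} (\<lambda>t. exp (\<nu> * (T - t) * r) *\<^sub>R
      (LINT p : strip t | lborel. (exp (- \<nu> * (T - fst p) * r) / c) *\<^sub>R N p))"
    by (intro continuous_intros continuous_on_integral_strip integrable)
  then show ?thesis
  proof (rule continuous_on_eq)
    fix t
    show "exp (\<nu> * (T - t) * r) *\<^sub>R (LINT p : strip t | lborel. (exp (- \<nu> * (T - fst p) * r) / c) *\<^sub>R N p)
        = (LINT p : strip t | lborel. (exp (- \<nu> * (t - fst p) * r) / c) *\<^sub>R N p)"
      unfolding duhamel_kernel_rescale[where t = t and T = T] set_integral_scaleR_right ..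
  qed
qed

subsection \<open>Gevrey weights\<close>

lemma powr_add_le_add_powr:
  fixes x y p :: real
  assumes "0 \<le> x" "0 \<le> y" "0 < p" "p \<le> 1"
  shows "(x + y) powr p \<le> x powr p + y powr p"
proof (cases "x + y = 0")
  case True
  then show ?thesis using assms by simp
next
  case False
  define s where "s = x + y"
  have "s > 0" using False assms by (simp add: s_def)
  have "z / s \<le> (z / s) powr p" if "0 \<le> z" "z \<le> s" for z
    using powr_mono'[of p 1 "z / s"] that \<open>s > 0\<close> assms by simp
  then have "x / s + y / s \<le> (x / s) powr p + (y / s) powr p"
    using assms by (intro add_mono) (auto simp: s_def)
  moreover have "x / s + y / s = 1"
    using \<open>s > 0\<close> by (simp add: s_def flip: add_divide_distrib)
  moreover have "(x / s) powr p + (y / s) powr p = (x powr p + y powr p) / s powr p"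
    using assms \<open>s > 0\<close> by (simp add: powr_divide add_divide_distrib)
  ultimately show ?thesis using \<open>s > 0\<close> by (simp add: s_def field_simps)
qed

definition gevrey_weight :: "real \<Rightarrow> real \<Rightarrow> 'a::real_normed_vector \<Rightarrow> real" where
  "gevrey_weight a \<sigma> \<xi> = exp (a * norm \<xi> powr (1 / \<sigma>))"

lemma gevrey_weight_submultiplicative:
  assumes "a \<ge> 0" "\<sigma> \<ge> 1"
  shows "gevrey_weight a \<sigma> \<xi> \<le> gevrey_weight a \<sigma> (\<xi> - \<eta>) * gevrey_weight a \<sigma> \<eta>"
proof -
  have "norm \<xi> \<le> norm (\<xi> - \<eta>) + norm \<eta>"
    using norm_triangle_ineq[of "\<xi> - \<eta>" \<eta>] by simp
  then have "norm \<xi> powr (1 / \<sigma>) \<le> (norm (\<xi> - \<eta>) + norm \<eta>) powr (1 / \<sigma>)"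
    using assms by (intro powr_mono2) auto
  also have "\<dots> \<le> norm (\<xi> - \<eta>) powr (1 / \<sigma>) + norm \<eta> powr (1 / \<sigma>)"
    using assms by (intro powr_add_le_add_powr) auto
  finally have "a * norm \<xi> powr (1 / \<sigma>) \<le> a * (norm (\<xi> - \<eta>) powr (1 / \<sigma>) + norm \<eta> powr (1 / \<sigma>))"
    using assms by (intro mult_left_mono) auto
  then show ?thesis by (simp add: gevrey_weight_def ring_distribs flip: exp_add)
qed

lemma measurable_gevrey_weight [measurable]:
  "gevrey_weight a \<sigma> \<in> borel_measurable (borel :: 'a::euclidean_space measure)"
  unfolding gevrey_weight_def[abs_def] by measurable

lemma zweight_nonneg [simp]: "zweight \<rho> a \<sigma> \<xi> \<ge> 0"
  by (simp add: zweight_def)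

lemma measurable_zweight [measurable]: "zweight \<rho> a \<sigma> \<in> borel_measurable borel"
  unfolding zweight_def[abs_def] by measurable

lemma AE_zweight_pos: "AE \<xi> in lborel. zweight \<rho> a \<sigma> \<xi> > 0"
  using AE_lborel_singleton[of 0] by eventually_elim (simp add: zweight_def)

lemma norm_mult_zweight: "norm \<xi> * zweight \<rho> a \<sigma> \<xi> = zweight (\<rho> + 1) a \<sigma> \<xi>"
  by (cases "\<xi> = 0") (simp_all add: zweight_def powr_add)

lemma power2_norm_mult_zweight: "(norm \<xi>)\<^sup>2 * zweight \<rho> a \<sigma> \<xi> = zweight (\<rho> + 2) a \<sigma> \<xi>"
  using norm_mult_zweight[of \<xi> \<rho>] norm_mult_zweight[of \<xi> "\<rho> + 1"]
  by (simp add: power2_eq_square mult.assoc add.commute[of 2])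

text \<open>Since \<open>0 powr 0 = 0\<close>, the weight \<open>zweight 0\<close> vanishes at the origin and is
  not submultiplicative there.\<close>

lemma weighted_norm_zweight_0: "weighted_norm (zweight 0 a \<sigma>) f = weighted_norm (gevrey_weight a \<sigma>) f"
  unfolding weighted_norm_def
proof (rule nn_integral_cong_AE)
  show "AE \<xi> in lborel. ennreal (zweight 0 a \<sigma> \<xi>) * f \<xi> = ennreal (gevrey_weight a \<sigma> \<xi>) * f \<xi>"
    using AE_lborel_singleton[of 0] by eventually_elim (simp add: zweight_def gevrey_weight_def)
qed

lemma Znorm_eq_weighted_norm: "Znorm \<rho> a \<sigma> f = weighted_norm (zweight \<rho> a \<sigma>) (\<lambda>\<xi>. ennreal (norm (f \<xi>)))"
  by (simp add: Znorm_def weighted_norm_def ennreal_mult)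

lemma tendsto_Znorm:
  assumes [measurable]: "\<And>s. s \<in> S \<Longrightarrow> v s \<in> borel_measurable borel" "v t \<in> borel_measurable borel"
    and finite: "Znorm \<rho> a \<sigma> (v t) < \<infinity>"
    and lim: "((\<lambda>s. Znorm \<rho> a \<sigma> (\<lambda>\<xi>. v s \<xi> - v t \<xi>)) \<longlongrightarrow> 0) (at t within S)"
  shows "((\<lambda>s. Znorm \<rho> a \<sigma> (v s)) \<longlongrightarrow> Znorm \<rho> a \<sigma> (v t)) (at t within S)"
proof (rule tendsto_sandwich)
  let ?N = "\<lambda>f. Znorm \<rho> a \<sigma> f" and ?d = "\<lambda>s. Znorm \<rho> a \<sigma> (\<lambda>\<xi>. v s \<xi> - v t \<xi>)"
  have triangle: "?N f \<le> ?N (\<lambda>\<xi>. f \<xi> - g \<xi>) + ?N g"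
    if [measurable]: "f \<in> borel_measurable borel" "g \<in> borel_measurable borel" for f g
    unfolding Znorm_eq_weighted_norm
    by (subst weighted_norm_add[symmetric])
      (measurable, intro weighted_norm_mono_AE AE_I2 ennreal_norm_triangle_sub)
  have "((\<lambda>s. ?N (v t) - ?d s) \<longlongrightarrow> ?N (v t) - 0) (at t within S)"
    using finite by (intro tendsto_diff_ennreal tendsto_const lim) auto
  then show "((\<lambda>s. ?N (v t) - ?d s) \<longlongrightarrow> ?N (v t)) (at t within S)" by simp
  have "((\<lambda>s. ?d s + ?N (v t)) \<longlongrightarrow> 0 + ?N (v t)) (at t within S)"
    by (intro tendsto_add tendsto_const lim)
  then show "((\<lambda>s. ?d s + ?N (v t)) \<longlongrightarrow> ?N (v t)) (at t within S)" by simp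
  have in_S: "\<forall>\<^sub>F s in at t within S. s \<in> S" by (simp add: eventually_at_filter)
  then show "\<forall>\<^sub>F s in at t within S. ?N (v s) \<le> ?d s + ?N (v t)"
    by eventually_elim (intro triangle assms)
  show "\<forall>\<^sub>F s in at t within S. ?N (v t) - ?d s \<le> ?N (v s)"
    using in_S
  proof eventually_elim
    case (elim s)
    have "?N (v t) \<le> ?N (\<lambda>\<xi>. v t \<xi> - v s \<xi>) + ?N (v s)"
      by (intro triangle assms elim)
    also have "?N (\<lambda>\<xi>. v t \<xi> - v s \<xi>) = ?d s"
      by (simp add: Znorm_def norm_minus_commute)
    finally show ?case using finite by (auto simp: ennreal_minus_le_iff)
  qed
qed

lemma Znorm_bounded_if_continuous:
  fixes v :: "real \<Rightarrow> real^3 \<Rightarrow> complex^3"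
  assumes "T \<ge> 0" and in_Zspace: "\<And>t. t \<in> {0..T} \<Longrightarrow> v t \<in> Zspace \<rho> a \<sigma>"
    and lim: "\<And>t. t \<in> {0..T} \<Longrightarrow> ((\<lambda>s. Znorm \<rho> a \<sigma> (\<lambda>\<xi>. v s \<xi> - v t \<xi>)) \<longlongrightarrow> 0) (at t within {0..T})"
  obtains B where "B < \<infinity>" "\<And>t. t \<in> {0..T} \<Longrightarrow> Znorm \<rho> a \<sigma> (v t) \<le> B"
proof -
  have cont: "continuous_on {0..T} (\<lambda>t. Znorm \<rho> a \<sigma> (v t))"
    unfolding continuous_on_def
    using in_Zspace lim by (intro ballI tendsto_Znorm) (auto simp: Zspace_def)
  then obtain t where "t \<in> {0..T}" "\<forall>s\<in>{0..T}. Znorm \<rho> a \<sigma> (v s) \<le> Znorm \<rho> a \<sigma> (v t)"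
    using continuous_attains_sup[OF compact_Icc _ cont] \<open>T \<ge> 0\<close> by auto
  moreover from this(1) have "Znorm \<rho> a \<sigma> (v t) < \<infinity>" using in_Zspace by (simp add: Zspace_def)
  ultimately show ?thesis by (intro that) auto
qed

lemma Znorm_tendsto_zero_dominated:
  fixes v :: "real \<Rightarrow> real^3 \<Rightarrow> complex^3"
  assumes [measurable]: "\<And>s. v s \<in> borel_measurable borel" "D \<in> borel_measurable borel"
    and dominated: "AE \<xi> in lborel. \<forall>s\<in>S. enorm v s \<xi> \<le> D \<xi>"
    and finite: "weighted_norm (zweight \<rho> a \<sigma>) D < \<infinity>"
    and cont: "AE \<xi> in lborel. continuous_on S (\<lambda>s. v s \<xi>)" and t: "t \<in> S"
  shows "((\<lambda>s. Znorm \<rho> a \<sigma> (\<lambda>\<xi>. v s \<xi> - v t \<xi>)) \<longlongrightarrow> 0) (at t within S)"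
  unfolding tendsto_at_iff_sequentially comp_def Znorm_eq_weighted_norm
proof (intro allI impI)
  fix X assume X: "\<forall>i. X i \<in> S - {t}" "X \<longlonglongrightarrow> t"
  show "(\<lambda>i. weighted_norm (zweight \<rho> a \<sigma>) (\<lambda>\<xi>. ennreal (norm (v (X i) \<xi> - v t \<xi>)))) \<longlonglongrightarrow> 0"
  proof (rule weighted_norm_tendsto_zero_dominated)
    show "weighted_norm (zweight \<rho> a \<sigma>) (\<lambda>\<xi>. 2 * D \<xi>) < \<infinity>"
      using finite by (simp add: weighted_norm_cmult ennreal_mult_less_top)
    show "AE \<xi> in lborel. ennreal (norm (v (X i) \<xi> - v t \<xi>)) \<le> 2 * D \<xi>" for i
      using dominated
    proof eventually_elim
      case (elim \<xi>)
      have "ennreal (norm (v (X i) \<xi> - v t \<xi>)) \<le> enorm v (X i) \<xi> + enorm v t \<xi>"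
        by (rule ennreal_norm_triangle_ineq4)
      also have "\<dots> \<le> D \<xi> + D \<xi>" using elim t X(1) by (intro add_mono) auto
      finally show ?case by (simp add: mult_2)
    qed
    show "AE \<xi> in lborel. (\<lambda>i. ennreal (norm (v (X i) \<xi> - v t \<xi>))) \<longlonglongrightarrow> 0"
      using cont
    proof eventually_elim
      case (elim \<xi>)
      have "(\<lambda>i. v (X i) \<xi>) \<longlonglongrightarrow> v t \<xi>"
        using X t by (intro continuous_on_tendsto_compose[OF elim]) auto
      then have "(\<lambda>i. ennreal (norm (v (X i) \<xi> - v t \<xi>))) \<longlonglongrightarrow> ennreal (norm (v t \<xi> - v t \<xi>))"
        by (intro tendsto_intros)
      then show ?case by simp
    qed
  qed measurable
qed

subsection \<open>Estimates in \<open>L\<^sup>2Z\<^sup>0\<close>\<close>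

locale gevrey_heat =
  fixes a \<sigma> \<nu> :: real
  assumes a_pos: "a > 0" and sigma_gt_1: "\<sigma> > 1" and nu_pos: "\<nu> > 0"
begin

abbreviation Zn :: "real \<Rightarrow> (real^3 \<Rightarrow> ennreal) \<Rightarrow> ennreal" where
  "Zn \<rho> \<equiv> weighted_norm (zweight \<rho> a \<sigma>)"

definition L2Z0_sq :: "real \<Rightarrow> (real \<Rightarrow> real^3 \<Rightarrow> ennreal) \<Rightarrow> ennreal" where
  "L2Z0_sq T m = (\<integral>\<^sup>+t\<in>{0..T}. (Zn 0 (m t))\<^sup>2 \<partial>lborel)"

lemma Zn_flux_majorant_le:
  assumes [measurable]: "f \<in> borel_measurable borel" "g \<in> borel_measurable borel"
  shows "Zn (-1) (flux_majorant f g) \<le> Zn 0 f * Zn 0 g"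
proof -
  have "Zn (-1) (flux_majorant f g) = Zn 0 (convolution f g)"
    unfolding flux_majorant_def[abs_def]
    by (subst weighted_norm_mult_ennreal) (simp_all add: norm_mult_zweight)
  also have "\<dots> \<le> Zn 0 f * Zn 0 g"
    unfolding weighted_norm_zweight_0 using a_pos sigma_gt_1
    by (intro weighted_norm_convolution_le gevrey_weight_submultiplicative)
      (simp_all add: gevrey_weight_def)
  finally show ?thesis .
qed

lemma nn_integral_Zn_flux_majorant_le:
  assumes [measurable]: "jointly_measurable m"
  shows "(\<integral>\<^sup>+s\<in>{0..T}. Zn (-1) (flux_majorant (m s) (m s)) \<partial>lborel) \<le> L2Z0_sq T m"
  unfolding L2Z0_sq_def power2_eq_square
  by (intro nn_integral_mono mult_right_mono Zn_flux_majorant_le) simp_all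

lemma L2Z0_sq_mono:
  assumes "\<And>t. t \<in> {0..T} \<Longrightarrow> AE \<xi> in lborel. m t \<xi> \<le> n t \<xi>"
  shows "L2Z0_sq T m \<le> L2Z0_sq T n"
proof -
  have "(Zn 0 (m t))\<^sup>2 \<le> (Zn 0 (n t))\<^sup>2" if "t \<in> {0..T}" for t
    by (intro power_mono weighted_norm_mono_AE assms that) simp
  then show ?thesis
    unfolding L2Z0_sq_def by (intro nn_integral_mono) (auto split: split_indicator)
qed

lemma L2Z0_sq_add_le:
  assumes [measurable]: "jointly_measurable m" "jointly_measurable n"
  shows "L2Z0_sq T (\<lambda>t \<xi>. m t \<xi> + n t \<xi>) \<le> 2 * L2Z0_sq T m + 2 * L2Z0_sq T n"
proof -
  let ?sq = "\<lambda>m t. (Zn 0 (m t))\<^sup>2 * indicator {0..T} t"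
  have "L2Z0_sq T (\<lambda>t \<xi>. m t \<xi> + n t \<xi>) = (\<integral>\<^sup>+t\<in>{0..T}. (Zn 0 (m t) + Zn 0 (n t))\<^sup>2 \<partial>lborel)"
    unfolding L2Z0_sq_def by (subst weighted_norm_add) measurable
  also have "\<dots> \<le> (\<integral>\<^sup>+t. 2 * ?sq m t + 2 * ?sq n t \<partial>lborel)"
    using power2_add_le_ennreal by (intro nn_integral_mono) (auto split: split_indicator)
  also have "\<dots> = 2 * L2Z0_sq T m + 2 * L2Z0_sq T n"
    unfolding L2Z0_sq_def by (simp add: nn_integral_add nn_integral_cmult)
  finally show ?thesis .
qed

lemma L2Z0_sq_SUP:
  assumes [measurable]: "\<And>n. jointly_measurable (m n)" and inc: "\<And>t \<xi>. incseq (\<lambda>n. m n t \<xi>)"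
  shows "L2Z0_sq T (\<lambda>t \<xi>. SUP n. m n t \<xi>) = (SUP n. L2Z0_sq T (m n))"
proof -
  have Zn_SUP: "Zn 0 (\<lambda>\<xi>. SUP n. m n t \<xi>) = (SUP n. Zn 0 (m n t))" for t
    unfolding weighted_norm_def SUP_mult_left_ennreal using inc
    by (intro nn_integral_monotone_convergence_SUP)
      (auto simp: incseq_def le_fun_def intro!: mult_left_mono)
  have inc_Zn: "incseq (\<lambda>n. Zn 0 (m n t))" for t
    using inc by (intro incseq_SucI weighted_norm_mono_AE AE_I2) (auto simp: incseq_Suc_iff)
  have "L2Z0_sq T (\<lambda>t \<xi>. SUP n. m n t \<xi>) = (\<integral>\<^sup>+t. (SUP n. (Zn 0 (m n t))\<^sup>2 * indicator {0..T} t) \<partial>lborel)"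
    unfolding L2Z0_sq_def Zn_SUP power2_SUP_ennreal[OF inc_Zn] SUP_mult_right_ennreal ..
  also have "\<dots> = (SUP n. L2Z0_sq T (m n))"
    unfolding L2Z0_sq_def using inc_Zn
    by (intro nn_integral_monotone_convergence_SUP)
      (auto simp: incseq_def le_fun_def intro!: mult_right_mono power_mono)
  finally show ?thesis .
qed

lemma L2Z0_sq_interpolation:
  assumes "jointly_measurable m" "\<And>t. t \<in> {0..T} \<Longrightarrow> Zn (-1) (m t) \<le> A"
  shows "L2Z0_sq T m \<le> A * (\<integral>\<^sup>+t\<in>{0..T}. Zn 1 (m t) \<partial>lborel)"
  using nn_integral_weighted_norm_interpolation[OF measurable_zweight assms(1) zweight_nonneg assms(2)]
  by (simp add: L2Z0_sq_def norm_mult_zweight power2_norm_mult_zweight)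

lemma L2Z0_sq_heat_duhamel_le:
  assumes "jointly_measurable h"
  shows "L2Z0_sq T (heat_duhamel \<nu> h) \<le> ennreal (1 / \<nu>) * (\<integral>\<^sup>+s\<in>{0..T}. Zn (-1) (h s) \<partial>lborel)\<^sup>2"
  using nn_integral_weighted_norm_heat_duhamel_power2_le[OF nu_pos
      measurable_zweight[of "-1" a \<sigma>] assms zweight_nonneg]
  by (simp add: L2Z0_sq_def norm_mult_zweight)

lemma L2Z0_sq_bilinear_duhamel_le:
  assumes [measurable]: "jointly_measurable m"
  shows "L2Z0_sq T (bilinear_duhamel \<nu> m m) \<le> ennreal (1 / \<nu>) * (L2Z0_sq T m)\<^sup>2"
proof -
  have "L2Z0_sq T (bilinear_duhamel \<nu> m m)
      \<le> ennreal (1 / \<nu>) * (\<integral>\<^sup>+s\<in>{0..T}. Zn (-1) (flux_majorant (m s) (m s)) \<partial>lborel)\<^sup>2"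
    unfolding bilinear_duhamel_def by (rule L2Z0_sq_heat_duhamel_le) measurable
  also have "\<dots> \<le> ennreal (1 / \<nu>) * (L2Z0_sq T m)\<^sup>2"
    by (intro mult_left_mono power_mono nn_integral_Zn_flux_majorant_le assms) simp_all
  finally show ?thesis .
qed

lemma nn_integral_Zn_1_bilinear_duhamel_le:
  assumes [measurable]: "jointly_measurable m"
  shows "(\<integral>\<^sup>+t\<in>{0..T}. Zn 1 (bilinear_duhamel \<nu> m m t) \<partial>lborel) \<le> ennreal (1 / \<nu>) * L2Z0_sq T m"
proof -
  have "(\<integral>\<^sup>+t\<in>{0..T}. Zn 1 (bilinear_duhamel \<nu> m m t) \<partial>lborel)
      \<le> ennreal (1 / \<nu>) * (\<integral>\<^sup>+s\<in>{0..T}. Zn (-1) (flux_majorant (m s) (m s)) \<partial>lborel)"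
    using nn_integral_weighted_norm_heat_duhamel_le[OF nu_pos measurable_zweight[of "-1" a \<sigma>],
        of "\<lambda>s. flux_majorant (m s) (m s)" T]
    by (simp add: bilinear_duhamel_def power2_norm_mult_zweight)
  also have "\<dots> \<le> ennreal (1 / \<nu>) * L2Z0_sq T m"
    by (intro mult_left_mono nn_integral_Zn_flux_majorant_le assms) simp
  finally show ?thesis .
qed

text \<open>Bounds \<open>bilinear_duhamel \<nu> m m t\<close> for all \<open>t \<le> T\<close> at once, so that a single
  null set serves every time.\<close>

definition total_flux :: "real \<Rightarrow> (real \<Rightarrow> real^3 \<Rightarrow> ennreal) \<Rightarrow> real^3 \<Rightarrow> ennreal" where
  "total_flux T m \<xi> = (\<integral>\<^sup>+s\<in>{0..T}. flux_majorant (m s) (m s) \<xi> \<partial>lborel)"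

lemma measurable_total_flux [measurable]:
  assumes [measurable]: "jointly_measurable m"
  shows "total_flux T m \<in> borel_measurable borel"
  unfolding total_flux_def[abs_def] by measurable

lemma bilinear_duhamel_le_total_flux: "t \<le> T \<Longrightarrow> bilinear_duhamel \<nu> m m t \<xi> \<le> total_flux T m \<xi>"
  unfolding bilinear_duhamel_def total_flux_def using nu_pos by (intro heat_duhamel_le_nn_integral) auto

lemma Zn_total_flux_le:
  assumes [measurable]: "jointly_measurable m"
  shows "Zn (-1) (total_flux T m) \<le> L2Z0_sq T m"
proof -
  have "Zn (-1) (total_flux T m) = (\<integral>\<^sup>+s\<in>{0..T}. Zn (-1) (flux_majorant (m s) (m s)) \<partial>lborel)"
    unfolding total_flux_def[abs_def] by (rule weighted_norm_nn_integral) measurable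
  also have "\<dots> \<le> L2Z0_sq T m" by (rule nn_integral_Zn_flux_majorant_le) fact
  finally show ?thesis .
qed

lemma AE_bilinear_duhamel_finite:
  assumes [measurable]: "jointly_measurable m" and finite: "L2Z0_sq T m < \<infinity>"
  shows "AE \<xi> in lborel. \<forall>t\<in>{0..T}. bilinear_duhamel \<nu> m m t \<xi> < \<infinity>"
proof -
  have "Zn (-1) (total_flux T m) < \<infinity>"
    using Zn_total_flux_le[OF assms(1)] finite by (rule order.strict_trans1)
  then have "AE \<xi> in lborel. total_flux T m \<xi> < \<infinity>"
    by (intro AE_finite_if_weighted_norm_finite[OF _ _ AE_zweight_pos]) measurable
  then show ?thesis
    by eventually_elim (auto intro: order.strict_trans1[OF bilinear_duhamel_le_total_flux])
qed

end

subsection \<open>Picard iteration and its scalar majorant\<close>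

locale ns_data = gevrey_heat +
  fixes u0 :: "real^3 \<Rightarrow> complex^3"
  assumes u0_Zspace: "u0 \<in> Zspace (-1) a \<sigma>"
    and u0_div_free: "AE \<xi> in lborel. cdot \<xi> (u0 \<xi>) = 0"
begin

definition heat_flow :: "real \<Rightarrow> real^3 \<Rightarrow> complex^3" where
  "heat_flow t \<xi> = exp (- \<nu> * t * (norm \<xi>)\<^sup>2) *\<^sub>R u0 \<xi>"

definition picard_map :: "(real \<Rightarrow> real^3 \<Rightarrow> complex^3) \<Rightarrow> real \<Rightarrow> real^3 \<Rightarrow> complex^3" where
  "picard_map v t \<xi> = heat_flow t \<xi> - duhamel_flux \<nu> v t \<xi>"

definition picard_equation :: "real \<Rightarrow> (real \<Rightarrow> real^3 \<Rightarrow> complex^3) \<Rightarrow> real^3 \<Rightarrow> bool" where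
  "picard_equation T v \<xi> \<longleftrightarrow> (\<forall>t\<in>{0..T}.
     set_integrable lborel (strip t) (flux_integrand \<nu> v v t \<xi>) \<and> v t \<xi> = picard_map v t \<xi>)"

definition picard_fixpoint :: "real \<Rightarrow> (real \<Rightarrow> real^3 \<Rightarrow> complex^3) \<Rightarrow> bool" where
  "picard_fixpoint T v \<longleftrightarrow> jointly_measurable v \<and> L2Z0_sq T (enorm v) < \<infinity> \<and>
     (AE \<xi> in lborel. picard_equation T v \<xi>)"

lemma measurable_u0 [measurable]: "u0 \<in> borel_measurable borel"
  using u0_Zspace by (simp add: Zspace_def)

lemma Zn_u0_finite: "Zn (-1) (\<lambda>\<xi>. ennreal (norm (u0 \<xi>))) < \<infinity>"
  using u0_Zspace by (simp add: Zspace_def Znorm_eq_weighted_norm)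

lemma measurable_heat_flow [measurable (raw)]:
  assumes [measurable]: "t \<in> borel_measurable M" "f \<in> borel_measurable M"
  shows "(\<lambda>x. heat_flow (t x) (f x)) \<in> borel_measurable M"
  unfolding heat_flow_def by measurable

lemma measurable_picard_map [measurable]:
  assumes [measurable]: "jointly_measurable v"
  shows "jointly_measurable (picard_map v)"
  unfolding picard_map_def[abs_def] by measurable

lemma enorm_heat_flow_le: "t \<ge> 0 \<Longrightarrow> enorm heat_flow t \<xi> \<le> ennreal (norm (u0 \<xi>))"
  using nu_pos by (auto simp: heat_flow_def intro!: ennreal_leI mult_left_le_one_le)

lemma nn_integral_Zn_1_heat_flow_le:
  "(\<integral>\<^sup>+t\<in>{0..T}. Zn 1 (enorm heat_flow t) \<partial>lborel)
      \<le> ennreal (1 / \<nu>) * Zn (-1) (\<lambda>\<xi>. ennreal (norm (u0 \<xi>)))"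
  using nn_integral_weighted_norm_heat_le[OF nu_pos measurable_zweight[of "-1" a \<sigma>] _ zweight_nonneg,
      of "\<lambda>\<xi>. ennreal (norm (u0 \<xi>))" T]
  by (simp add: heat_flow_def power2_norm_mult_zweight ennreal_mult)

lemma L2Z0_sq_heat_flow_finite: "L2Z0_sq T (enorm heat_flow) < \<infinity>"
proof -
  let ?U = "Zn (-1) (\<lambda>\<xi>. ennreal (norm (u0 \<xi>)))"
  have "L2Z0_sq T (enorm heat_flow) \<le> ?U * (\<integral>\<^sup>+t\<in>{0..T}. Zn 1 (enorm heat_flow t) \<partial>lborel)"
  proof (rule L2Z0_sq_interpolation)
    show "Zn (-1) (enorm heat_flow t) \<le> ?U" if "t \<in> {0..T}" for t
      using that by (intro weighted_norm_mono_AE AE_I2 enorm_heat_flow_le) simp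
  qed measurable
  also have "\<dots> \<le> ?U * (ennreal (1 / \<nu>) * ?U)"
    by (intro mult_left_mono nn_integral_Zn_1_heat_flow_le) simp
  also have "\<dots> < \<infinity>" using Zn_u0_finite by (simp add: ennreal_mult_less_top)
  finally show ?thesis .
qed

lemma L2Z0_sq_heat_flow_small:
  assumes "\<epsilon> > 0"
  obtains T where "T > 0" "L2Z0_sq T (enorm heat_flow) \<le> ennreal \<epsilon>"
proof -
  have "(\<lambda>t. (Zn 0 (enorm heat_flow t))\<^sup>2) \<in> borel_measurable borel" by measurable
  from nn_integral_small_on_short_intervals[OF this
      L2Z0_sq_heat_flow_finite[of 1, unfolded L2Z0_sq_def] assms]
  obtain \<delta> where "\<delta> > 0"
    and \<delta>: "\<And>x y. 0 \<le> x \<Longrightarrow> x \<le> y \<Longrightarrow> y \<le> 1 \<Longrightarrow> y - x < \<delta>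
       \<Longrightarrow> (\<integral>\<^sup>+t\<in>{x..y}. (Zn 0 (enorm heat_flow t))\<^sup>2 \<partial>lborel) < ennreal \<epsilon>"
    by blast
  show ?thesis
  proof
    show "min 1 (\<delta> / 2) > 0" using \<open>\<delta> > 0\<close> by simp
    show "L2Z0_sq (min 1 (\<delta> / 2)) (enorm heat_flow) \<le> ennreal \<epsilon>"
      using \<delta>[of 0 "min 1 (\<delta> / 2)"] \<open>\<delta> > 0\<close> unfolding L2Z0_sq_def
      by (simp add: min_less_iff_disj less_imp_le)
  qed
qed

primrec picard :: "nat \<Rightarrow> real \<Rightarrow> real^3 \<Rightarrow> complex^3" where
  "picard 0 = (\<lambda>_ _. 0)"
| "picard (Suc n) = picard_map (picard n)"

primrec scalar_picard :: "nat \<Rightarrow> real \<Rightarrow> real^3 \<Rightarrow> ennreal" where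
  "scalar_picard 0 = (\<lambda>_ _. 0)"
| "scalar_picard (Suc n)
    = (\<lambda>t \<xi>. enorm heat_flow t \<xi> + bilinear_duhamel \<nu> (scalar_picard n) (scalar_picard n) t \<xi>)"

definition picard_majorant :: "real \<Rightarrow> real^3 \<Rightarrow> ennreal" where
  "picard_majorant t \<xi> = (SUP n. scalar_picard n t \<xi>)"

definition picard_limit :: "real \<Rightarrow> real^3 \<Rightarrow> complex^3" where
  "picard_limit t \<xi> = lim (\<lambda>n. picard n t \<xi>)"

lemma measurable_picard [measurable]: "jointly_measurable (picard n)"
  by (induction n) simp_all

lemma measurable_scalar_picard [measurable]: "jointly_measurable (scalar_picard n)"
proof (induction n)
  case (Suc n)
  note [measurable] = Suc
  show ?case unfolding scalar_picard.simps by measurable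
qed simp

lemma measurable_picard_majorant [measurable]: "jointly_measurable picard_majorant"
  unfolding picard_majorant_def[abs_def] case_prod_beta' by measurable

lemma measurable_picard_limit [measurable]: "jointly_measurable picard_limit"
  unfolding picard_limit_def[abs_def] case_prod_beta' by measurable

text \<open>Holds at every point, also where the Bochner integrals diverge: there the right-hand side is
  infinite. The summand \<open>scalar_picard n\<close> on the left replaces a subtraction in \<open>ennreal\<close>.\<close>

lemma picard_increment_and_norm_le:
  "ennreal (norm (picard (Suc n) t \<xi> - picard n t \<xi>)) + scalar_picard n t \<xi> \<le> scalar_picard (Suc n) t \<xi>
    \<and> enorm (picard n) t \<xi> \<le> scalar_picard n t \<xi>"
proof (induction n arbitrary: t \<xi>)
  case 0
  have "duhamel_flux \<nu> (\<lambda>_ _. 0) t \<xi> = 0"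
    by (simp add: duhamel_flux_def flux_integrand_def leray_flux.zero_left)
  then show ?case by (simp add: picard_map_def)
next
  case (Suc n)
  have norm_le: "enorm (picard (Suc n)) s \<eta> \<le> scalar_picard (Suc n) s \<eta>" for s \<eta>
  proof -
    have "enorm (picard (Suc n)) s \<eta>
        \<le> ennreal (norm (picard (Suc n) s \<eta> - picard n s \<eta>)) + enorm (picard n) s \<eta>"
      by (rule ennreal_norm_triangle_sub)
    also have "\<dots> \<le> ennreal (norm (picard (Suc n) s \<eta> - picard n s \<eta>)) + scalar_picard n s \<eta>"
      using Suc by (intro add_left_mono) blast
    also have "\<dots> \<le> scalar_picard (Suc n) s \<eta>" using Suc by blast
    finally show ?thesis .
  qed
  let ?B = "\<lambda>m. bilinear_duhamel \<nu> m m t \<xi>"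
  let ?\<Delta> = "ennreal (norm (duhamel_flux \<nu> (picard (Suc n)) t \<xi> - duhamel_flux \<nu> (picard n) t \<xi>))"
  have "picard (Suc (Suc n)) t \<xi> - picard (Suc n) t \<xi>
      = duhamel_flux \<nu> (picard n) t \<xi> - duhamel_flux \<nu> (picard (Suc n)) t \<xi>"
    unfolding picard.simps(2)[of "Suc n"] by (subst picard.simps(2)[of n]) (simp add: picard_map_def)
  then have "ennreal (norm (picard (Suc (Suc n)) t \<xi> - picard (Suc n) t \<xi>)) + scalar_picard (Suc n) t \<xi>
      = enorm heat_flow t \<xi> + (?\<Delta> + ?B (scalar_picard n))"
    by (simp only: norm_minus_commute scalar_picard.simps(2)) (simp only: ac_simps)
  also have "\<dots> \<le> enorm heat_flow t \<xi> + ?B (scalar_picard (Suc n))"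
    by (intro add_left_mono duhamel_flux_diff_majorant[OF measurable_picard measurable_picard
          measurable_scalar_picard measurable_scalar_picard]) (use Suc norm_le in blast)+
  finally show ?case using norm_le unfolding scalar_picard.simps(2)[of "Suc n"] by blast
qed

lemma incseq_scalar_picard: "incseq (\<lambda>n. scalar_picard n t \<xi>)"
proof (rule incseq_SucI)
  fix n
  have "scalar_picard n t \<xi> \<le> ennreal (norm (picard (Suc n) t \<xi> - picard n t \<xi>)) + scalar_picard n t \<xi>"
    by (simp add: add_increasing)
  then show "scalar_picard n t \<xi> \<le> scalar_picard (Suc n) t \<xi>"
    using picard_increment_and_norm_le order_trans by blast
qed

lemma scalar_picard_le_majorant: "scalar_picard n t \<xi> \<le> picard_majorant t \<xi>"
  unfolding picard_majorant_def by (rule SUP_upper) simp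

lemma enorm_picard_le_majorant: "enorm (picard n) t \<xi> \<le> picard_majorant t \<xi>"
  using picard_increment_and_norm_le[of n t \<xi>] scalar_picard_le_majorant[of n t \<xi>]
  by (blast intro: order_trans)

lemma picard_tendsto_limit:
  assumes "picard_majorant t \<xi> < \<infinity>"
  shows "(\<lambda>n. picard n t \<xi>) \<longlonglongrightarrow> picard_limit t \<xi>"
proof -
  have "convergent (\<lambda>n. picard n t \<xi>)"
    using picard_increment_and_norm_le assms unfolding picard_majorant_def
    by (intro convergent_if_dominated_increments[where m = "\<lambda>n. scalar_picard n t \<xi>"]) blast+
  then show ?thesis unfolding picard_limit_def by (simp add: convergent_LIMSEQ_iff)
qed

lemma enorm_picard_limit_le: "enorm picard_limit t \<xi> \<le> picard_majorant t \<xi>"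
proof (cases "picard_majorant t \<xi> < \<infinity>")
  case True
  have "(\<lambda>n. enorm (picard n) t \<xi>) \<longlonglongrightarrow> enorm picard_limit t \<xi>"
    by (intro tendsto_ennrealI tendsto_norm picard_tendsto_limit True)
  then show ?thesis by (rule LIMSEQ_le_const2) (use enorm_picard_le_majorant in blast)
next
  case False
  then show ?thesis by (simp add: less_top[symmetric])
qed

lemma picard_majorant_le:
  "picard_majorant t \<xi> \<le> enorm heat_flow t \<xi> + bilinear_duhamel \<nu> picard_majorant picard_majorant t \<xi>"
  unfolding picard_majorant_def[of t]
proof (rule SUP_least)
  fix n
  show "scalar_picard n t \<xi>
      \<le> enorm heat_flow t \<xi> + bilinear_duhamel \<nu> picard_majorant picard_majorant t \<xi>"
    by (cases n) (auto intro!: add_left_mono bilinear_duhamel_mono scalar_picard_le_majorant)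
qed

text \<open>With \<open>q\<^sub>n\<close> the square of the \<open>L\<^sup>2Z\<^sup>0\<close> norm of the \<open>n\<close>-th iterate, \<open>q\<^sub>n\<^sub>+\<^sub>1 \<le> 2 \<cdot> (\<nu> / 16) + 2 q\<^sub>n\<^sup>2 / \<nu>\<close>,
  and \<open>\<nu> / 4\<close> is the fixed point of the right-hand side.\<close>

lemma L2Z0_sq_scalar_picard_le:
  assumes heat_flow: "L2Z0_sq T (enorm heat_flow) \<le> ennreal (\<nu> / 16)"
  shows "L2Z0_sq T (scalar_picard n) \<le> ennreal (\<nu> / 4)"
proof (induction n)
  case 0
  show ?case by (simp add: L2Z0_sq_def)
next
  case (Suc n)
  have two_mult: "2 * ennreal r = ennreal (2 * r)" if "r \<ge> 0" for r
    using that by (simp add: ennreal_mult)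
  let ?Q = "bilinear_duhamel \<nu> (scalar_picard n) (scalar_picard n)"
  have "L2Z0_sq T ?Q \<le> ennreal (1 / \<nu>) * (L2Z0_sq T (scalar_picard n))\<^sup>2"
    by (rule L2Z0_sq_bilinear_duhamel_le) measurable
  also have "\<dots> \<le> ennreal (1 / \<nu>) * (ennreal (\<nu> / 4))\<^sup>2"
    by (intro mult_left_mono power_mono Suc) simp_all
  also have "\<dots> = ennreal (\<nu> / 16)"
    using nu_pos by (simp add: ennreal_power power2_eq_square flip: ennreal_mult)
  finally have Q_le: "L2Z0_sq T ?Q \<le> ennreal (\<nu> / 16)" .
  have "L2Z0_sq T (scalar_picard (Suc n)) \<le> 2 * L2Z0_sq T (enorm heat_flow) + 2 * L2Z0_sq T ?Q"
    unfolding scalar_picard.simps by (rule L2Z0_sq_add_le) measurable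
  also have "\<dots> \<le> 2 * ennreal (\<nu> / 16) + 2 * ennreal (\<nu> / 16)"
    by (intro add_mono mult_left_mono heat_flow Q_le) simp_all
  also have "\<dots> = ennreal (\<nu> / 4)"
    using nu_pos by (simp add: two_mult flip: ennreal_plus)
  finally show ?case .
qed

lemma L2Z0_sq_picard_majorant_finite:
  assumes "L2Z0_sq T (enorm heat_flow) \<le> ennreal (\<nu> / 16)"
  shows "L2Z0_sq T picard_majorant < \<infinity>"
proof -
  have "L2Z0_sq T picard_majorant = (SUP n. L2Z0_sq T (scalar_picard n))"
    unfolding picard_majorant_def[abs_def]
    by (rule L2Z0_sq_SUP[OF measurable_scalar_picard incseq_scalar_picard])
  also have "\<dots> \<le> ennreal (\<nu> / 4)" by (intro SUP_least L2Z0_sq_scalar_picard_le assms)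
  finally show ?thesis by (simp add: order.strict_trans1)
qed

lemma picard_limit_fixpoint:
  assumes finite: "L2Z0_sq T picard_majorant < \<infinity>"
  shows "picard_fixpoint T picard_limit"
  unfolding picard_fixpoint_def
proof (intro conjI)
  show "jointly_measurable picard_limit" by measurable
  have "L2Z0_sq T (enorm picard_limit) \<le> L2Z0_sq T picard_majorant"
    by (intro L2Z0_sq_mono AE_I2 enorm_picard_limit_le)
  then show "L2Z0_sq T (enorm picard_limit) < \<infinity>" using finite by (rule order.strict_trans1)
  let ?B = "bilinear_duhamel \<nu> picard_majorant picard_majorant"
  have B_finite: "AE \<xi> in lborel. \<forall>t\<in>{0..T}. ?B t \<xi> < \<infinity>"
    by (rule AE_bilinear_duhamel_finite[OF measurable_picard_majorant finite])
  have majorant_finite: "picard_majorant t \<xi> < \<infinity>" if "?B t \<xi> < \<infinity>" for t \<xi>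
    using picard_majorant_le[of t \<xi>] that by (auto intro: order.strict_trans1)
  have lim: "AE \<eta> in lborel. \<forall>s\<in>{0..T}. (\<lambda>n. picard n s \<eta>) \<longlonglongrightarrow> picard_limit s \<eta>"
    using B_finite by eventually_elim (use majorant_finite picard_tendsto_limit in blast)
  show "AE \<xi> in lborel. picard_equation T picard_limit \<xi>"
    unfolding picard_equation_def using B_finite lim
  proof (eventually_elim, intro ballI conjI)
    fix \<xi> t assume B: "\<forall>t\<in>{0..T}. ?B t \<xi> < \<infinity>" and t: "t \<in> {0..T}"
      and lim_\<xi>: "\<forall>s\<in>{0..T}. (\<lambda>n. picard n s \<xi>) \<longlonglongrightarrow> picard_limit s \<xi>"
    have "bilinear_duhamel \<nu> (enorm picard_limit) (enorm picard_limit) t \<xi> \<le> ?B t \<xi>"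
      by (intro bilinear_duhamel_mono enorm_picard_limit_le)
    with B t show "set_integrable lborel (strip t) (flux_integrand \<nu> picard_limit picard_limit t \<xi>)"
      by (intro set_integrable_flux_integrand measurable_picard_limit) (auto intro: order.strict_trans1)
    have "AE \<eta> in lborel. \<forall>s\<in>{0..t}. (\<lambda>n. picard n s \<eta>) \<longlonglongrightarrow> picard_limit s \<eta>"
      using lim by eventually_elim (use t in auto)
    then have "(\<lambda>n. picard_map (picard n) t \<xi>) \<longlonglongrightarrow> picard_map picard_limit t \<xi>"
      unfolding picard_map_def using B t
      by (intro tendsto_diff tendsto_const duhamel_flux_tendsto[where m = picard_majorant]
          enorm_picard_le_majorant) auto
    moreover have "(\<lambda>n. picard_map (picard n) t \<xi>) \<longlonglongrightarrow> picard_limit t \<xi>"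
      using LIMSEQ_Suc[of "\<lambda>n. picard n t \<xi>" "picard_limit t \<xi>"] lim_\<xi> t by simp
    ultimately show "picard_limit t \<xi> = picard_map picard_limit t \<xi>" by (rule LIMSEQ_unique[symmetric])
  qed
qed

lemma picard_fixpoint_exists: "\<exists>T>0. \<exists>v. picard_fixpoint T v"
proof -
  obtain T where "T > 0" "L2Z0_sq T (enorm heat_flow) \<le> ennreal (\<nu> / 16)"
    using L2Z0_sq_heat_flow_small[of "\<nu> / 16"] nu_pos by auto
  then show ?thesis using picard_limit_fixpoint L2Z0_sq_picard_majorant_finite by blast
qed

subsection \<open>Fixed points are mild solutions\<close>

lemma
  assumes "picard_fixpoint T v"
  shows picard_fixpoint_measurable: "jointly_measurable v"
    and picard_fixpoint_L2Z0: "L2Z0_sq T (enorm v) < \<infinity>"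
    and picard_fixpoint_AE: "AE \<xi> in lborel. picard_equation T v \<xi>"
  using assms by (simp_all add: picard_fixpoint_def)

lemma cdot_heat_flow: "cdot \<xi> (u0 \<xi>) = 0 \<Longrightarrow> cdot \<xi> (heat_flow t \<xi>) = 0"
  by (simp add: heat_flow_def cdot_scaleR)

lemma picard_fixpoint_div_free:
  assumes "picard_fixpoint T v"
  shows "AE \<xi> in lborel. \<forall>t\<in>{0..T}. cdot \<xi> (v t \<xi>) = 0"
  using picard_fixpoint_AE[OF assms] u0_div_free
  by eventually_elim
    (simp add: picard_equation_def picard_map_def cdot_diff cdot_heat_flow cdot_duhamel_flux)

lemma picard_fixpoint_enorm_le:
  assumes "picard_fixpoint T v"
  shows "AE \<xi> in lborel. \<forall>t\<in>{0..T}. enorm v t \<xi>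
      \<le> enorm heat_flow t \<xi> + bilinear_duhamel \<nu> (enorm v) (enorm v) t \<xi>"
  using picard_fixpoint_AE[OF assms]
proof (eventually_elim, intro ballI)
  fix \<xi> t assume "picard_equation T v \<xi>" "t \<in> {0..T}"
  then have "v t \<xi> = heat_flow t \<xi> - duhamel_flux \<nu> v t \<xi>"
    by (simp add: picard_equation_def picard_map_def)
  then have "enorm v t \<xi> \<le> enorm heat_flow t \<xi> + enorm (duhamel_flux \<nu> v) t \<xi>"
    by (simp add: ennreal_norm_triangle_ineq4)
  also have "\<dots> \<le> enorm heat_flow t \<xi> + bilinear_duhamel \<nu> (enorm v) (enorm v) t \<xi>"
    by (intro add_left_mono norm_duhamel_flux_le picard_fixpoint_measurable[OF assms])
  finally show "enorm v t \<xi> \<le> enorm heat_flow t \<xi> + bilinear_duhamel \<nu> (enorm v) (enorm v) t \<xi>" .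
qed

lemma picard_fixpoint_dominated:
  assumes fixpoint: "picard_fixpoint T v"
  obtains D where "D \<in> borel_measurable borel" "Zn (-1) D < \<infinity>"
    "AE \<xi> in lborel. \<forall>t\<in>{0..T}. enorm v t \<xi> \<le> D \<xi>"
proof
  note [measurable] = picard_fixpoint_measurable[OF fixpoint]
  let ?D = "\<lambda>\<xi>. ennreal (norm (u0 \<xi>)) + total_flux T (enorm v) \<xi>"
  show "?D \<in> borel_measurable borel" by measurable
  have "Zn (-1) ?D = Zn (-1) (\<lambda>\<xi>. ennreal (norm (u0 \<xi>))) + Zn (-1) (total_flux T (enorm v))"
    by (rule weighted_norm_add) measurable
  moreover have "Zn (-1) (total_flux T (enorm v)) \<le> L2Z0_sq T (enorm v)"
    by (rule Zn_total_flux_le) measurable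
  ultimately show "Zn (-1) ?D < \<infinity>"
    using Zn_u0_finite picard_fixpoint_L2Z0[OF fixpoint] by (auto intro: order.strict_trans1)
  show "AE \<xi> in lborel. \<forall>t\<in>{0..T}. enorm v t \<xi> \<le> ?D \<xi>"
    using picard_fixpoint_enorm_le[OF fixpoint]
  proof (eventually_elim, intro ballI)
    fix \<xi> t assume "\<forall>t\<in>{0..T}. enorm v t \<xi>
        \<le> enorm heat_flow t \<xi> + bilinear_duhamel \<nu> (enorm v) (enorm v) t \<xi>"
      and t: "t \<in> {0..T}"
    then have "enorm v t \<xi> \<le> enorm heat_flow t \<xi> + bilinear_duhamel \<nu> (enorm v) (enorm v) t \<xi>" by blast
    also have "\<dots> \<le> ?D \<xi>"
      using t by (intro add_mono enorm_heat_flow_le bilinear_duhamel_le_total_flux) auto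
    finally show "enorm v t \<xi> \<le> ?D \<xi>" .
  qed
qed

lemma picard_fixpoint_continuous:
  assumes fixpoint: "picard_fixpoint T v" and "T \<ge> 0"
  shows "AE \<xi> in lborel. continuous_on {0..T} (\<lambda>t. v t \<xi>)"
  using picard_fixpoint_AE[OF fixpoint]
proof eventually_elim
  case (elim \<xi>)
  then have "set_integrable lborel (strip T) (flux_integrand \<nu> v v T \<xi>)"
    using \<open>T \<ge> 0\<close> by (simp add: picard_equation_def)
  then have "continuous_on {0..T} (\<lambda>t. duhamel_flux \<nu> v t \<xi>)"
    unfolding duhamel_flux_def flux_integrand_def by (rule continuous_on_duhamel)
  then have "continuous_on {0..T} (\<lambda>t. picard_map v t \<xi>)"
    unfolding picard_map_def heat_flow_def by (intro continuous_intros)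
  then show ?case by (rule continuous_on_eq) (use elim in \<open>simp add: picard_equation_def\<close>)
qed

lemma nn_integral_Zn_1_picard_fixpoint_finite:
  assumes fixpoint: "picard_fixpoint T v"
  shows "(\<integral>\<^sup>+t\<in>{0..T}. Zn 1 (enorm v t) \<partial>lborel) < \<infinity>"
proof -
  note [measurable] = picard_fixpoint_measurable[OF fixpoint]
  let ?B = "bilinear_duhamel \<nu> (enorm v) (enorm v)"
  have Zn_le: "Zn 1 (enorm v t) \<le> Zn 1 (enorm heat_flow t) + Zn 1 (?B t)" if "t \<in> {0..T}" for t
  proof -
    have "Zn 1 (enorm v t) \<le> Zn 1 (\<lambda>\<xi>. enorm heat_flow t \<xi> + ?B t \<xi>)"
      using picard_fixpoint_enorm_le[OF fixpoint] that
      by (intro weighted_norm_mono_AE) (auto elim!: eventually_mono)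
    also have "\<dots> = Zn 1 (enorm heat_flow t) + Zn 1 (?B t)" by (rule weighted_norm_add) measurable
    finally show ?thesis .
  qed
  have "(\<integral>\<^sup>+t\<in>{0..T}. Zn 1 (enorm v t) \<partial>lborel)
      \<le> (\<integral>\<^sup>+t. Zn 1 (enorm heat_flow t) * indicator {0..T} t + Zn 1 (?B t) * indicator {0..T} t \<partial>lborel)"
    using Zn_le by (intro nn_integral_mono) (auto split: split_indicator)
  also have "\<dots> = (\<integral>\<^sup>+t\<in>{0..T}. Zn 1 (enorm heat_flow t) \<partial>lborel) + (\<integral>\<^sup>+t\<in>{0..T}. Zn 1 (?B t) \<partial>lborel)"
    by (rule nn_integral_add) measurable
  also have "\<dots>
      \<le> ennreal (1 / \<nu>) * Zn (-1) (\<lambda>\<xi>. ennreal (norm (u0 \<xi>))) + ennreal (1 / \<nu>) * L2Z0_sq T (enorm v)"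
    by (intro add_mono nn_integral_Zn_1_heat_flow_le nn_integral_Zn_1_bilinear_duhamel_le) measurable
  also have "\<dots> < \<infinity>"
    using Zn_u0_finite picard_fixpoint_L2Z0[OF fixpoint] by (simp add: ennreal_mult_less_top)
  finally show ?thesis .
qed

definition convective_picard_map :: "(real \<Rightarrow> real^3 \<Rightarrow> complex^3) \<Rightarrow> real \<Rightarrow> real^3 \<Rightarrow> complex^3" where
  "convective_picard_map v t \<xi>
      = heat_flow t \<xi> - (LINT p : strip t | lborel. duhamel_integrand \<nu> v t \<xi> p)"

lemma cdot_convective_picard_map: "cdot \<xi> (u0 \<xi>) = 0 \<Longrightarrow> cdot \<xi> (convective_picard_map v t \<xi>) = 0"
  unfolding convective_picard_map_def
  by (subst cdot_diff, subst cdot_set_lebesgue_integral_eq_0)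
    (simp_all add: cdot_heat_flow duhamel_integrand_def cdot_scaleR cdot_leray)

lemma
  assumes v: "jointly_measurable v"
    and div_free: "AE \<xi> in lborel. \<forall>t\<in>{0..T}. cdot \<xi> (v t \<xi>) = 0" and t: "t \<in> {0..T}"
  shows set_integrable_duhamel_integrand_iff:
      "set_integrable lborel (strip t) (duhamel_integrand \<nu> v t \<xi>)
      \<longleftrightarrow> set_integrable lborel (strip t) (flux_integrand \<nu> v v t \<xi>)"
    and convective_picard_map_eq: "convective_picard_map v t \<xi> = picard_map v t \<xi>"
proof -
  have "AE \<xi> in lborel. \<forall>s\<in>{0..t}. cdot \<xi> (v s \<xi>) = 0"
    using div_free by eventually_elim (use t in auto)
  note cong = set_borel_measurable_duhamel_integrand[OF v] set_borel_measurable_flux_integrand[OF v v]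
    AE_duhamel_integrand_eq_flux_integrand[OF this]
  show "set_integrable lborel (strip t) (duhamel_integrand \<nu> v t \<xi>)
      \<longleftrightarrow> set_integrable lborel (strip t) (flux_integrand \<nu> v v t \<xi>)"
    by (rule set_integrable_cong_AE_on[OF cong])
  show "convective_picard_map v t \<xi> = picard_map v t \<xi>"
    unfolding convective_picard_map_def picard_map_def duhamel_flux_def
    by (simp only: set_lebesgue_integral_cong_AE_on[OF cong])
qed

lemma NS_mild_solution_iff:
  "NS_mild_solution \<nu> a \<sigma> T u0 v \<longleftrightarrow>
     (\<forall>t\<in>{0..T}. v t \<in> Zspace (-1) a \<sigma>) \<and>
     (\<forall>t\<in>{0..T}. ((\<lambda>s. Znorm (-1) a \<sigma> (\<lambda>\<xi>. v s \<xi> - v t \<xi>)) \<longlongrightarrow> 0) (at t within {0..T})) \<and>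
     (\<integral>\<^sup>+t\<in>{0..T}. Zn 1 (enorm v t) \<partial>lborel) < \<infinity> \<and>
     (\<forall>t\<in>{0..T}. AE \<xi> in lborel. set_integrable lborel (strip t) (duhamel_integrand \<nu> v t \<xi>)
        \<and> v t \<xi> = convective_picard_map v t \<xi>)"
  by (simp only: NS_mild_solution_def convective_picard_map_def heat_flow_def
      Znorm_eq_weighted_norm[of 1])

lemma picard_fixpoint_imp_mild_solution:
  assumes fixpoint: "picard_fixpoint T v" and "T \<ge> 0"
  shows "NS_mild_solution \<nu> a \<sigma> T u0 v"
  unfolding NS_mild_solution_iff
proof (intro conjI ballI nn_integral_Zn_1_picard_fixpoint_finite fixpoint)
  note [measurable] = picard_fixpoint_measurable[OF fixpoint]
  have v: "v t \<in> borel_measurable borel" for t by measurable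
  from picard_fixpoint_dominated[OF fixpoint] obtain D where D: "D \<in> borel_measurable borel"
    "Zn (-1) D < \<infinity>" "AE \<xi> in lborel. \<forall>t\<in>{0..T}. enorm v t \<xi> \<le> D \<xi>" .
  fix t assume t: "t \<in> {0..T}"
  have "Zn (-1) (enorm v t) \<le> Zn (-1) D"
    using D(3) t by (intro weighted_norm_mono_AE) (auto elim!: eventually_mono)
  then show "v t \<in> Zspace (-1) a \<sigma>"
    using D(2) v by (simp add: Zspace_def Znorm_eq_weighted_norm order.strict_trans1)
  show "((\<lambda>s. Znorm (-1) a \<sigma> (\<lambda>\<xi>. v s \<xi> - v t \<xi>)) \<longlongrightarrow> 0) (at t within {0..T})"
    by (rule Znorm_tendsto_zero_dominated[OF v D(1,3,2) picard_fixpoint_continuous[OF assms] t])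
  show "AE \<xi> in lborel. set_integrable lborel (strip t) (duhamel_integrand \<nu> v t \<xi>)
      \<and> v t \<xi> = convective_picard_map v t \<xi>"
    using picard_fixpoint_AE[OF fixpoint]
  proof eventually_elim
    case (elim \<xi>)
    note convective = picard_fixpoint_measurable[OF fixpoint] picard_fixpoint_div_free[OF fixpoint] t
    show ?case
      using elim t unfolding picard_equation_def
      by (simp add: set_integrable_duhamel_integrand_iff[OF convective]
          convective_picard_map_eq[OF convective])
  qed
qed

subsection \<open>Mild solutions are fixed points\<close>

text \<open>A mild solution need not be jointly measurable in \<open>(t, \<xi>)\<close>, so Tonelli does not apply to it
  directly; its Duhamel formula is continuous in \<open>t\<close> for almost every \<open>\<xi>\<close> and supplies a jointly
  measurable modification.\<close>

lemma mild_solution_modification: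
  assumes sol: "NS_mild_solution \<nu> a \<sigma> T u0 w" and "T \<ge> 0"
  obtains v where "jointly_measurable v" "AE \<xi> in lborel. \<forall>t\<in>{0..T}. v t \<xi> = convective_picard_map w t \<xi>"
proof -
  have eq: "AE \<xi> in lborel. w t \<xi> = convective_picard_map w t \<xi>" if "t \<in> {0..T}" for t
    using sol that unfolding NS_mild_solution_iff by (auto elim: eventually_mono)
  have "AE \<xi> in lborel. set_integrable lborel (strip T) (duhamel_integrand \<nu> w T \<xi>)"
    using sol \<open>T \<ge> 0\<close> unfolding NS_mild_solution_iff by (auto elim: eventually_mono)
  then have cont: "AE \<xi> in lborel. continuous_on {0..T} (\<lambda>t. convective_picard_map w t \<xi>)"
  proof eventually_elim
    case (elim \<xi>)
    then have "continuous_on {0..T} (\<lambda>t. LINT p : strip t | lborel. duhamel_integrand \<nu> w t \<xi> p)"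
      unfolding duhamel_integrand_def by (rule continuous_on_duhamel)
    then show ?case
      unfolding convective_picard_map_def heat_flow_def by (intro continuous_intros)
  qed
  have "w t \<in> borel_measurable lborel" if "t \<in> {0..T}" for t
    using sol that by (simp add: NS_mild_solution_iff Zspace_def)
  from jointly_measurable_modification[OF \<open>T \<ge> 0\<close> this eq cont] obtain v
    where "case_prod v \<in> borel_measurable (borel \<Otimes>\<^sub>M lborel)"
      and v: "AE \<xi> in lborel. \<forall>t\<in>{0..T}. v t \<xi> = convective_picard_map w t \<xi>"
    by blast
  moreover have "sets (borel \<Otimes>\<^sub>M lborel) = sets (borel \<Otimes>\<^sub>M borel :: (real \<times> (real^3)) measure)"
    by (rule sets_pair_measure_cong) simp_all
  ultimately have "jointly_measurable v" by (simp cong: measurable_cong_sets)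
  then show ?thesis using v by (rule that)
qed

lemma mild_solution_L2Z0:
  assumes sol: "NS_mild_solution \<nu> a \<sigma> T u0 w" and "T \<ge> 0" and v: "jointly_measurable v"
    and eq: "\<And>t. t \<in> {0..T} \<Longrightarrow> AE \<xi> in lborel. w t \<xi> = v t \<xi>"
  shows "L2Z0_sq T (enorm v) < \<infinity>"
proof -
  have Zn_eq: "Zn \<rho> (enorm v t) = Zn \<rho> (enorm w t)" if "t \<in> {0..T}" for t \<rho>
    using eq[OF that] by (intro weighted_norm_cong_AE) (auto elim!: eventually_mono)
  obtain B where B: "B < \<infinity>" "\<And>t. t \<in> {0..T} \<Longrightarrow> Znorm (-1) a \<sigma> (w t) \<le> B"
    by (rule Znorm_bounded_if_continuous[OF \<open>T \<ge> 0\<close>, of w "-1" a \<sigma>])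
      (use sol in \<open>auto simp: NS_mild_solution_iff\<close>)
  have [measurable]: "jointly_measurable (enorm v)" using v by measurable
  have "L2Z0_sq T (enorm v) \<le> B * (\<integral>\<^sup>+t\<in>{0..T}. Zn 1 (enorm v t) \<partial>lborel)"
    using B(2) by (intro L2Z0_sq_interpolation) (simp_all add: Zn_eq Znorm_eq_weighted_norm)
  also have "(\<integral>\<^sup>+t\<in>{0..T}. Zn 1 (enorm v t) \<partial>lborel) = (\<integral>\<^sup>+t\<in>{0..T}. Zn 1 (enorm w t) \<partial>lborel)"
    by (intro nn_integral_cong) (simp add: Zn_eq split: split_indicator)
  also have "B * \<dots> < \<infinity>"
    using sol B(1) by (simp add: NS_mild_solution_iff ennreal_mult_less_top)
  finally show ?thesis .
qed

lemma picard_equation_if_AE_eq_convective: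
  assumes v: "jointly_measurable v" and div_free: "AE \<xi> in lborel. \<forall>t\<in>{0..T}. cdot \<xi> (v t \<xi>) = 0"
    and eq: "\<And>t. t \<in> {0..T} \<Longrightarrow> AE \<xi> in lborel. w t \<xi> = v t \<xi>"
    and integrable: "set_integrable lborel (strip T) (duhamel_integrand \<nu> w T \<xi>)"
    and v_eq: "\<forall>t\<in>{0..T}. v t \<xi> = convective_picard_map w t \<xi>"
  shows "picard_equation T v \<xi>"
  unfolding picard_equation_def
proof
  fix t assume t: "t \<in> {0..T}"
  have w_integrable: "set_integrable lborel (strip t) (duhamel_integrand \<nu> w t \<xi>)"
    using t unfolding duhamel_integrand_def
    by (intro set_integrable_duhamel[OF integrable[unfolded duhamel_integrand_def]]) simp
  then have w_measurable: "set_borel_measurable lborel (strip t) (duhamel_integrand \<nu> w t \<xi>)"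
    unfolding set_integrable_def set_borel_measurable_def by (rule borel_measurable_integrable)
  have eq_t: "AE \<eta> in lborel. w s \<eta> = v s \<eta>" if "s \<in> {0..t}" for s
    using eq[of s] that t by simp
  note cong = w_measurable set_borel_measurable_duhamel_integrand[OF v]
      AE_duhamel_integrand_cong[OF w_measurable v eq_t]
  have "set_integrable lborel (strip t) (duhamel_integrand \<nu> v t \<xi>)"
    using w_integrable set_integrable_cong_AE_on[OF cong] by simp
  moreover have "v t \<xi> = convective_picard_map v t \<xi>"
    using v_eq t set_lebesgue_integral_cong_AE_on[OF cong] by (simp add: convective_picard_map_def)
  ultimately show "set_integrable lborel (strip t) (flux_integrand \<nu> v v t \<xi>) \<and> v t \<xi> = picard_map v t \<xi>"
    using set_integrable_duhamel_integrand_iff[OF v div_free t] convective_picard_map_eq[OF v div_free t]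
    by simp
qed

lemma mild_solution_imp_picard_fixpoint:
  assumes sol: "NS_mild_solution \<nu> a \<sigma> T u0 w" and "T \<ge> 0"
  obtains v where "picard_fixpoint T v" "\<And>t. t \<in> {0..T} \<Longrightarrow> AE \<xi> in lborel. w t \<xi> = v t \<xi>"
proof -
  obtain v where v: "jointly_measurable v"
    and v_eq: "AE \<xi> in lborel. \<forall>t\<in>{0..T}. v t \<xi> = convective_picard_map w t \<xi>"
    using mild_solution_modification[OF assms] .
  have w_eq: "AE \<xi> in lborel. set_integrable lborel (strip t) (duhamel_integrand \<nu> w t \<xi>)
      \<and> w t \<xi> = convective_picard_map w t \<xi>" if "t \<in> {0..T}" for t
    using sol that by (simp add: NS_mild_solution_iff)
  have eq: "AE \<xi> in lborel. w t \<xi> = v t \<xi>" if "t \<in> {0..T}" for t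
    using w_eq[OF that] v_eq by eventually_elim (use that in auto)
  have div_free: "AE \<xi> in lborel. \<forall>t\<in>{0..T}. cdot \<xi> (v t \<xi>) = 0"
    using v_eq u0_div_free by eventually_elim (simp add: cdot_convective_picard_map)
  have "AE \<xi> in lborel. set_integrable lborel (strip T) (duhamel_integrand \<nu> w T \<xi>)"
    using w_eq[of T] \<open>T \<ge> 0\<close> by simp
  then have "AE \<xi> in lborel. picard_equation T v \<xi>"
    using v_eq by eventually_elim (rule picard_equation_if_AE_eq_convective[OF v div_free eq])
  then have "picard_fixpoint T v"
    using v mild_solution_L2Z0[OF assms v eq] by (simp add: picard_fixpoint_def)
  then show ?thesis using eq by (rule that)
qed

end

subsection \<open>Uniqueness\<close>

definition flux_diff_majorant ::
  "(real \<Rightarrow> real^3 \<Rightarrow> complex^3) \<Rightarrow> (real \<Rightarrow> real^3 \<Rightarrow> complex^3) \<Rightarrow> real \<Rightarrow> real^3 \<Rightarrow> ennreal" where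
  "flux_diff_majorant v w s \<xi> = flux_majorant (\<lambda>\<eta>. ennreal (norm (v s \<eta> - w s \<eta>))) (enorm v s) \<xi>
     + flux_majorant (enorm w s) (\<lambda>\<eta>. ennreal (norm (v s \<eta> - w s \<eta>))) \<xi>"

lemma measurable_flux_diff_majorant [measurable]:
  assumes [measurable]: "jointly_measurable v" "jointly_measurable w"
  shows "jointly_measurable (flux_diff_majorant v w)"
  unfolding flux_diff_majorant_def[abs_def] by measurable

lemma (in gevrey_heat) Zn_flux_diff_majorant_le:
  assumes [measurable]: "v s \<in> borel_measurable borel" "w s \<in> borel_measurable borel"
  shows "Zn (-1) (flux_diff_majorant v w s)
    \<le> (Zn 0 (enorm v s) + Zn 0 (enorm w s)) * Zn 0 (\<lambda>\<eta>. ennreal (norm (v s \<eta> - w s \<eta>)))"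
proof -
  let ?d = "\<lambda>\<eta>. ennreal (norm (v s \<eta> - w s \<eta>))"
  have "Zn (-1) (flux_diff_majorant v w s)
      = Zn (-1) (flux_majorant ?d (enorm v s)) + Zn (-1) (flux_majorant (enorm w s) ?d)"
    unfolding flux_diff_majorant_def[abs_def] by (rule weighted_norm_add) measurable
  also have "\<dots> \<le> Zn 0 ?d * Zn 0 (enorm v s) + Zn 0 (enorm w s) * Zn 0 ?d"
    by (intro add_mono Zn_flux_majorant_le) measurable
  also have "\<dots> = (Zn 0 (enorm v s) + Zn 0 (enorm w s)) * Zn 0 ?d"
    by (simp add: algebra_simps)
  finally show ?thesis .
qed

context ns_data
begin

lemma picard_fixpoint_diff_le:
  assumes v: "picard_fixpoint T v" and w: "picard_fixpoint T w"
  shows "AE \<xi> in lborel. \<forall>t\<in>{0..T}. ennreal (norm (v t \<xi> - w t \<xi>))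
      \<le> heat_duhamel \<nu> (flux_diff_majorant v w) t \<xi>"
  using picard_fixpoint_AE[OF v] picard_fixpoint_AE[OF w]
proof (eventually_elim, intro ballI)
  fix \<xi> t
  assume "picard_equation T v \<xi>" "picard_equation T w \<xi>" "t \<in> {0..T}"
  then have int: "set_integrable lborel (strip t) (flux_integrand \<nu> v v t \<xi>)"
      "set_integrable lborel (strip t) (flux_integrand \<nu> w w t \<xi>)"
    and eq: "v t \<xi> = picard_map v t \<xi>" "w t \<xi> = picard_map w t \<xi>"
    by (auto simp: picard_equation_def)
  note [measurable] = picard_fixpoint_measurable[OF v] picard_fixpoint_measurable[OF w]
  have "norm (v t \<xi> - w t \<xi>) = norm (duhamel_flux \<nu> v t \<xi> - duhamel_flux \<nu> w t \<xi>)"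
    unfolding eq by (simp add: picard_map_def norm_minus_commute)
  then have "ennreal (norm (v t \<xi> - w t \<xi>))
      \<le> bilinear_duhamel \<nu> (enorm (\<lambda>s \<eta>. v s \<eta> - w s \<eta>)) (enorm v) t \<xi> +
          bilinear_duhamel \<nu> (enorm w) (enorm (\<lambda>s \<eta>. v s \<eta> - w s \<eta>)) t \<xi>"
    using norm_duhamel_flux_diff_le[OF _ _ int] by simp
  also have "\<dots> = heat_duhamel \<nu> (flux_diff_majorant v w) t \<xi>"
    unfolding bilinear_duhamel_def flux_diff_majorant_def[abs_def]
    by (rule heat_duhamel_add[symmetric]) measurable
  finally show "ennreal (norm (v t \<xi> - w t \<xi>)) \<le> heat_duhamel \<nu> (flux_diff_majorant v w) t \<xi>" .
qed

lemma nn_integral_Zn_flux_diff_majorant_eq_0: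
  assumes v: "picard_fixpoint T v" and w: "picard_fixpoint T w" and "T \<ge> 0"
  shows "(\<integral>\<^sup>+s\<in>{0..T}. Zn (-1) (flux_diff_majorant v w s) \<partial>lborel) = 0"
proof -
  note [measurable] = picard_fixpoint_measurable[OF v] picard_fixpoint_measurable[OF w]
  define d where "d t \<xi> = ennreal (norm (v t \<xi> - w t \<xi>))" for t \<xi>
  define m where "m t \<xi> = enorm v t \<xi> + enorm w t \<xi>" for t \<xi>
  have [measurable]: "jointly_measurable d" unfolding d_def by measurable
  have [measurable]: "jointly_measurable m" unfolding m_def by measurable
  have "Zn 0 (m s) = Zn 0 (enorm v s) + Zn 0 (enorm w s)" for s
    unfolding m_def by (rule weighted_norm_add) measurable
  then have "Zn (-1) (flux_diff_majorant v w s) \<le> Zn 0 (m s) * Zn 0 (d s)" for s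
    using Zn_flux_diff_majorant_le[of v s w] unfolding d_def by simp
  then have flux_le: "(\<integral>\<^sup>+s\<in>{0..\<tau>}. Zn (-1) (flux_diff_majorant v w s) \<partial>lborel)
      \<le> (\<integral>\<^sup>+s\<in>{0..\<tau>}. Zn 0 (m s) * Zn 0 (d s) \<partial>lborel)" for \<tau>
    by (intro nn_integral_mono mult_right_mono) simp_all
  have "(\<integral>\<^sup>+t\<in>{0..T}. Zn 0 (m t) * Zn 0 (d t) \<partial>lborel) = 0"
  proof (rule gronwall_L2[where K = "1 / \<nu>"])
    have "L2Z0_sq T m \<le> 2 * L2Z0_sq T (enorm v) + 2 * L2Z0_sq T (enorm w)"
      unfolding m_def by (rule L2Z0_sq_add_le) measurable
    also have "\<dots> < \<infinity>"
      using picard_fixpoint_L2Z0[OF v] picard_fixpoint_L2Z0[OF w] by (simp add: ennreal_mult_less_top)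
    finally show "(\<integral>\<^sup>+t\<in>{0..T}. (Zn 0 (m t))\<^sup>2 \<partial>lborel) < \<infinity>" by (simp add: L2Z0_sq_def)
    show "Zn 0 (d t) \<le> Zn 0 (m t)" for t
      unfolding d_def m_def by (intro weighted_norm_mono_AE AE_I2 ennreal_norm_triangle_ineq4)
    fix \<tau> assume \<tau>: "0 \<le> \<tau>" "\<tau> \<le> T"
    have "L2Z0_sq \<tau> d \<le> L2Z0_sq \<tau> (heat_duhamel \<nu> (flux_diff_majorant v w))"
      using picard_fixpoint_diff_le[OF v w] \<tau> unfolding d_def
      by (intro L2Z0_sq_mono) (auto elim!: eventually_mono)
    also have "\<dots> \<le> ennreal (1 / \<nu>) * (\<integral>\<^sup>+s\<in>{0..\<tau>}. Zn (-1) (flux_diff_majorant v w s) \<partial>lborel)\<^sup>2"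
      by (rule L2Z0_sq_heat_duhamel_le) measurable
    also have "\<dots> \<le> ennreal (1 / \<nu>) * (\<integral>\<^sup>+t\<in>{0..\<tau>}. Zn 0 (m t) * Zn 0 (d t) \<partial>lborel)\<^sup>2"
      by (intro mult_left_mono power_mono flux_le) simp_all
    finally show "(\<integral>\<^sup>+t\<in>{0..\<tau>}. (Zn 0 (d t))\<^sup>2 \<partial>lborel)
        \<le> ennreal (1 / \<nu>) * (\<integral>\<^sup>+t\<in>{0..\<tau>}. Zn 0 (m t) * Zn 0 (d t) \<partial>lborel)\<^sup>2"
      by (simp only: L2Z0_sq_def)
  qed (use \<open>T \<ge> 0\<close> nu_pos in auto)
  then show ?thesis using flux_le[of T] by simp
qed

lemma picard_fixpoint_unique:
  assumes v: "picard_fixpoint T v" and w: "picard_fixpoint T w" and t: "t \<in> {0..T}"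
  shows "AE \<xi> in lborel. v t \<xi> = w t \<xi>"
proof -
  note [measurable] = picard_fixpoint_measurable[OF v] picard_fixpoint_measurable[OF w]
  let ?d = "\<lambda>\<xi>. ennreal (norm (v t \<xi> - w t \<xi>))"
  have "Zn (-1) ?d \<le> Zn (-1) (heat_duhamel \<nu> (flux_diff_majorant v w) t)"
    using picard_fixpoint_diff_le[OF v w] t
    by (intro weighted_norm_mono_AE) (auto elim!: eventually_mono)
  also have "\<dots> \<le> (\<integral>\<^sup>+s\<in>{0..T}. Zn (-1) (flux_diff_majorant v w s) \<partial>lborel)"
    using nu_pos t by (intro weighted_norm_heat_duhamel_le) auto
  also have "\<dots> = 0"
    using t by (intro nn_integral_Zn_flux_diff_majorant_eq_0 v w) simp
  finally have "Zn (-1) ?d = 0" by simp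
  then have "AE \<xi> in lborel. ?d \<xi> = 0"
    by (intro AE_zero_if_weighted_norm_zero[OF _ _ AE_zweight_pos]) measurable
  then show ?thesis by eventually_elim (simp add: ennreal_eq_0_iff)
qed

end

theorem theorem3p1:
  fixes a \<sigma> \<nu> :: real and u0 :: "real^3 \<Rightarrow> complex^3"
  assumes "a > 0" and "\<sigma> > 1" and "\<nu> > 0"
    and "u0 \<in> Zspace (-1) a \<sigma>"
    and "AE \<xi> in lborel. (\<Sum>j\<in>UNIV. complex_of_real (\<xi> $ j) * u0 \<xi> $ j) = 0"
  shows "\<exists>T>0. \<exists>v. NS_mild_solution \<nu> a \<sigma> T u0 v \<and>
           (\<forall>w. NS_mild_solution \<nu> a \<sigma> T u0 w \<longrightarrow>
                 (\<forall>t\<in>{0..T}. AE \<xi> in lborel. w t \<xi> = v t \<xi>))"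
proof -
  interpret ns_data a \<sigma> \<nu> u0
    using assms by unfold_locales (simp_all add: cdot_def)
  obtain T v where T: "T > 0" and v: "picard_fixpoint T v" using picard_fixpoint_exists by blast
  have "AE \<xi> in lborel. w t \<xi> = v t \<xi>" if w: "NS_mild_solution \<nu> a \<sigma> T u0 w" and t: "t \<in> {0..T}" for w t
  proof -
    obtain w' where w': "picard_fixpoint T w'" "AE \<xi> in lborel. w t \<xi> = w' t \<xi>"
      using mild_solution_imp_picard_fixpoint[OF w] T t by (metis less_imp_le)
    from w'(2) picard_fixpoint_unique[OF w'(1) v t] show ?thesis by eventually_elim simp
  qed
  then show ?thesis using picard_fixpoint_imp_mild_solution[OF v] T by (meson less_imp_le)
qed

end
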